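(* Let $R$ be a ring (not necessarily unital) and let $\alpha\in R$ be an idempotent. Then the semigroup homomorphism $\mathcal{V}(\alpha R\alpha)\to\mathcal{V}(R)$ induced by $-\otimes_{\alpha R\alpha}\alpha R$, that is, $[P]\mapsto[P\otimes_{\alpha R\alpha}\alpha R]$, is injective. Moreover, $$\mathcal{V}(\alpha R\alpha)\cong\overline{\langle[\alpha R]\rangle}\subseteq\mathcal{V}(R),$$ where $\overline{\langle[\alpha R]\rangle}$ denotes the closure in $\mathcal{V}(R)$ of the subsemigroup generated by $[\alpha R]$.
   Context: For any ring $R$, $\mathcal{V}(R)$ is the additive commutative monoid of isomorphism classes $[P]$ of finitely generated projective right $R$-modules $P$, with addition given by direct sum. For an idempotent $\alpha\in R$, $\alpha R\alpha$ is the corner ring associated with $\alpha$; it is a unital ring with unit $\alpha$, whether or not $R$ has a unit. $\alpha R$ is an $(\alpha R\alpha,R)$-bimodule that is finitely generated (in fact cyclic) projective as a right $R$-module. On a commutative additive semigroup $S$ define the pre-order $x\preccurlyeq y$ if and only if there is $z\in S$ with $x+z=y$. For a subset $A\subseteq S$ its closure is $\overline{A}=\{x\in S:\ x\preccurlyeq s\text{ for some }s\in A\}$; if $A$ is a subsemigroup then so is $\overline{A}$. The isomorphism in the claim is an isomorphism of semigroups. *)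

theory Defs
  imports "HOL-Algebra.Ring" "HOL-Algebra.Coset" "HOL-Algebra.Generated_Groups"
    "HOL-Algebra.Free_Abelian_Groups"
begin

section \<open>Rings without unit\<close>

text \<open>
  The record type of rings in \<^theory>\<open>HOL-Algebra.Ring\<close> is reused, but its field
  \<^const>\<open>one\<close> is not constrained by the locale below, and no construction on a ring
  that is needed here reads it.
\<close>

locale rng = abelian_group R for R (structure) +
  assumes rng_m_closed: "\<lbrakk>x \<in> carrier R; y \<in> carrier R\<rbrakk> \<Longrightarrow> x \<otimes> y \<in> carrier R"
    and rng_m_assoc: "\<lbrakk>x \<in> carrier R; y \<in> carrier R; z \<in> carrier R\<rbrakk>
          \<Longrightarrow> (x \<otimes> y) \<otimes> z = x \<otimes> (y \<otimes> z)"
    and rng_l_distr: "\<lbrakk>x \<in> carrier R; y \<in> carrier R; z \<in> carrier R\<rbrakk>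
          \<Longrightarrow> (x \<oplus> y) \<otimes> z = x \<otimes> z \<oplus> y \<otimes> z"
    and rng_r_distr: "\<lbrakk>x \<in> carrier R; y \<in> carrier R; z \<in> carrier R\<rbrakk>
          \<Longrightarrow> z \<otimes> (x \<oplus> y) = z \<otimes> x \<oplus> z \<otimes> y"

definition corner_ring :: "('a, 'c) ring_scheme \<Rightarrow> 'a \<Rightarrow> 'a ring" where
  "corner_ring R \<alpha> =
    \<lparr>carrier = {\<alpha> \<otimes>\<^bsub>R\<^esub> x \<otimes>\<^bsub>R\<^esub> \<alpha> | x. x \<in> carrier R},
     monoid.mult = monoid.mult R, one = \<alpha>, ring.zero = ring.zero R, ring.add = ring.add R\<rparr>"

text \<open>The Dorroh extension \<open>\<int> \<times> R\<close>, in which \<open>R\<close> sits as the ideal \<open>{0} \<times> R\<close>.\<close>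

definition unitization :: "('a, 'c) ring_scheme \<Rightarrow> (int \<times> 'a) ring" where
  "unitization R =
    \<lparr>carrier = UNIV \<times> carrier R,
     monoid.mult = (\<lambda>(m, x) (n, y).
       (m * n, [m] \<cdot>\<^bsub>R\<^esub> y \<oplus>\<^bsub>R\<^esub> [n] \<cdot>\<^bsub>R\<^esub> x \<oplus>\<^bsub>R\<^esub> x \<otimes>\<^bsub>R\<^esub> y)),
     one = (1, \<zero>\<^bsub>R\<^esub>),
     ring.zero = (0, \<zero>\<^bsub>R\<^esub>),
     ring.add = (\<lambda>(m, x) (n, y). (m + n, x \<oplus>\<^bsub>R\<^esub> y))\<rparr>"


section \<open>Right modules and bimodules\<close>

text \<open>
  The group operation \<^const>\<open>monoid.mult\<close> of the underlying monoid record is the addition of the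
  module, so that the library constructions on groups apply to modules.
\<close>

record ('r, 'm) rmodule = "'m monoid" +
  ract :: "'m \<Rightarrow> 'r \<Rightarrow> 'm"  (infixl \<open>\<star>\<index>\<close> 75)

definition right_module ::
    "('r, 'c) ring_scheme \<Rightarrow> ('r, 'm, 'd) rmodule_scheme \<Rightarrow> bool" where
  "right_module R M \<longleftrightarrow>
     comm_group M \<and>
     (\<forall>x\<in>carrier M. \<forall>r\<in>carrier R. x \<star>\<^bsub>M\<^esub> r \<in> carrier M) \<and>
     (\<forall>x\<in>carrier M. \<forall>y\<in>carrier M. \<forall>r\<in>carrier R.
        (x \<otimes>\<^bsub>M\<^esub> y) \<star>\<^bsub>M\<^esub> r = (x \<star>\<^bsub>M\<^esub> r) \<otimes>\<^bsub>M\<^esub> (y \<star>\<^bsub>M\<^esub> r)) \<and>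
     (\<forall>x\<in>carrier M. \<forall>r\<in>carrier R. \<forall>s\<in>carrier R.
        x \<star>\<^bsub>M\<^esub> (r \<oplus>\<^bsub>R\<^esub> s) = (x \<star>\<^bsub>M\<^esub> r) \<otimes>\<^bsub>M\<^esub> (x \<star>\<^bsub>M\<^esub> s)) \<and>
     (\<forall>x\<in>carrier M. \<forall>r\<in>carrier R. \<forall>s\<in>carrier R.
        x \<star>\<^bsub>M\<^esub> (r \<otimes>\<^bsub>R\<^esub> s) = (x \<star>\<^bsub>M\<^esub> r) \<star>\<^bsub>M\<^esub> s)"

definition rmodule_hom ::
    "('r, 'c) ring_scheme \<Rightarrow> ('r, 'm, 'd) rmodule_scheme \<Rightarrow> ('r, 'n, 'e) rmodule_scheme
       \<Rightarrow> ('m \<Rightarrow> 'n) set" where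
  "rmodule_hom R M N =
    {f \<in> hom M N. \<forall>x\<in>carrier M. \<forall>r\<in>carrier R. f (x \<star>\<^bsub>M\<^esub> r) = f x \<star>\<^bsub>N\<^esub> r}"

definition rmodule_iso ::
    "('r, 'c) ring_scheme \<Rightarrow> ('r, 'm, 'd) rmodule_scheme \<Rightarrow> ('r, 'n, 'e) rmodule_scheme
       \<Rightarrow> bool" where
  "rmodule_iso R M N \<longleftrightarrow>
    (\<exists>f \<in> rmodule_hom R M N. bij_betw f (carrier M) (carrier N))"

definition zero_rmodule :: "('r, unit) rmodule" where
  "zero_rmodule = \<lparr>carrier = {()}, monoid.mult = (\<lambda>_ _. ()), one = (), ract = (\<lambda>_ _. ())\<rparr>"

definition direct_sum ::
    "('r, 'm, 'd) rmodule_scheme \<Rightarrow> ('r, 'n, 'e) rmodule_scheme \<Rightarrow> ('r, 'm \<times> 'n) rmodule"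
  where
  "direct_sum M N =
    \<lparr>carrier = carrier M \<times> carrier N,
     monoid.mult = (\<lambda>(x, y) (x', y'). (x \<otimes>\<^bsub>M\<^esub> x', y \<otimes>\<^bsub>N\<^esub> y')),
     one = (\<one>\<^bsub>M\<^esub>, \<one>\<^bsub>N\<^esub>),
     ract = (\<lambda>(x, y) r. (x \<star>\<^bsub>M\<^esub> r, y \<star>\<^bsub>N\<^esub> r))\<rparr>"

text \<open>
  Right \<open>R\<close>-modules are the same as unital right modules over the unitization of \<open>R\<close>.
  The free right \<open>R\<close>-module on \<open>X\<close> is therefore the module of finitely supported functions
  from \<open>X\<close> to the unitization; functions are extended by zero outside \<open>X\<close>.
\<close>

definition free_rmodule ::
    "('r, 'c) ring_scheme \<Rightarrow> 'x set \<Rightarrow> ('r, 'x \<Rightarrow> int \<times> 'r) rmodule" where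
  "free_rmodule R X =
    \<lparr>carrier = {f. (\<forall>x. f x \<in> carrier (unitization R)) \<and>
                   finite {x. f x \<noteq> \<zero>\<^bsub>unitization R\<^esub>} \<and>
                   {x. f x \<noteq> \<zero>\<^bsub>unitization R\<^esub>} \<subseteq> X},
     monoid.mult = (\<lambda>f g x. f x \<oplus>\<^bsub>unitization R\<^esub> g x),
     one = (\<lambda>_. \<zero>\<^bsub>unitization R\<^esub>),
     ract = (\<lambda>f r x. f x \<otimes>\<^bsub>unitization R\<^esub> (0, r))\<rparr>"

text \<open>
  Projective means: direct summand of a free module. Since every module is a quotient of the
  free module on its own underlying set, and a complement can be chosen inside that free
  module, restricting \<open>X\<close> and \<open>Q\<close> to the types below excludes nothing.
\<close>

definition projective :: "('r, 'c) ring_scheme \<Rightarrow> ('r, 'm, 'd) rmodule_scheme \<Rightarrow> bool" where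
  "projective R P \<longleftrightarrow>
    right_module R P \<and>
    (\<exists>(X :: 'm set) (Q :: ('r, 'm \<Rightarrow> int \<times> 'r) rmodule).
       right_module R Q \<and> rmodule_iso R (direct_sum P Q) (free_rmodule R X))"

text \<open>
  Finitely generated means \<open>P = x\<^sub>1R + \<dots> + x\<^sub>nR\<close>, and in particular \<open>P = PR\<close>. So a finitely
  generated module over a ring with unit is automatically unital, and over an arbitrary ring
  the finitely generated projective modules are exactly those finitely generated projective
  modules \<open>P\<close> over the unitization which satisfy \<open>P = PR\<close>.
\<close>

definition finitely_generated ::
    "('r, 'c) ring_scheme \<Rightarrow> ('r, 'm, 'd) rmodule_scheme \<Rightarrow> bool" where
  "finitely_generated R P \<longleftrightarrow>
    right_module R P \<and>
    (\<exists>X. finite X \<and> X \<subseteq> carrier P \<and>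
       carrier P = generate P {x \<star>\<^bsub>P\<^esub> r | x r. x \<in> X \<and> r \<in> carrier R})"

definition fg_projective ::
    "('r, 'c) ring_scheme \<Rightarrow> ('r, 'm, 'd) rmodule_scheme \<Rightarrow> bool" where
  "fg_projective R P \<longleftrightarrow> finitely_generated R P \<and> projective R P"

record ('s, 'r, 'm) bimodule = "('r, 'm) rmodule" +
  lact :: "'s \<Rightarrow> 'm \<Rightarrow> 'm"

text \<open>\<open>\<alpha>R\<close> as an \<open>(\<alpha>R\<alpha>, R)\<close>-bimodule\<close>

definition corner_bimodule :: "('a, 'c) ring_scheme \<Rightarrow> 'a \<Rightarrow> ('a, 'a, 'a) bimodule" where
  "corner_bimodule R \<alpha> =
    \<lparr>carrier = {\<alpha> \<otimes>\<^bsub>R\<^esub> x | x. x \<in> carrier R},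
     monoid.mult = ring.add R, one = ring.zero R,
     ract = (\<lambda>x r. x \<otimes>\<^bsub>R\<^esub> r), lact = (\<lambda>s x. s \<otimes>\<^bsub>R\<^esub> x)\<rparr>"


section \<open>Tensor products\<close>

text \<open>
  \<open>P \<otimes>\<^sub>S B\<close> is the free abelian group on \<open>P \<times> B\<close> modulo the subgroup generated by the
  following relators. Addition and subtraction of formal sums are \<open>+\<close> and \<open>-\<close>, and
  \<^term>\<open>frag_of (p, b)\<close> is the formal generator that represents \<open>p \<otimes> b\<close>.
\<close>

definition tensor_relators ::
    "('s, 'c) ring_scheme \<Rightarrow> ('s, 'm, 'd) rmodule_scheme \<Rightarrow> ('s, 'r, 'n, 'e) bimodule_scheme
       \<Rightarrow> ('m \<times> 'n \<Rightarrow>\<^sub>0 int) set" where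
  "tensor_relators S P B =
     {frag_of (p \<otimes>\<^bsub>P\<^esub> p', b) - (frag_of (p, b) + frag_of (p', b)) | p p' b.
        p \<in> carrier P \<and> p' \<in> carrier P \<and> b \<in> carrier B} \<union>
     {frag_of (p, b \<otimes>\<^bsub>B\<^esub> b') - (frag_of (p, b) + frag_of (p, b')) | p b b'.
        p \<in> carrier P \<and> b \<in> carrier B \<and> b' \<in> carrier B} \<union>
     {frag_of (p \<star>\<^bsub>P\<^esub> s, b) - frag_of (p, lact B s b) | p s b.
        p \<in> carrier P \<and> s \<in> carrier S \<and> b \<in> carrier B}"

definition tensor_kernel ::
    "('s, 'c) ring_scheme \<Rightarrow> ('s, 'm, 'd) rmodule_scheme \<Rightarrow> ('s, 'r, 'n, 'e) bimodule_scheme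
       \<Rightarrow> ('m \<times> 'n \<Rightarrow>\<^sub>0 int) set" where
  "tensor_kernel S P B =
     generate (free_Abelian_group (carrier P \<times> carrier B)) (tensor_relators S P B)"

text \<open>
  The right action is induced by \<open>(p \<otimes> b) r = p \<otimes> b r\<close>: a coset \<open>C\<close> is sent to the coset of
  the image of any of its elements (the union ranges over equal cosets).
\<close>

definition tensor_product ::
    "('s, 'c) ring_scheme \<Rightarrow> ('s, 'm, 'd) rmodule_scheme \<Rightarrow> ('s, 'r, 'n, 'e) bimodule_scheme
       \<Rightarrow> ('r, ('m \<times> 'n \<Rightarrow>\<^sub>0 int) set) rmodule" where
  "tensor_product S P B =
    (let F = free_Abelian_group (carrier P \<times> carrier B); K = tensor_kernel S P B in
     \<lparr>carrier = carrier (F Mod K),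
      monoid.mult = monoid.mult (F Mod K),
      one = one (F Mod K),
      ract = (\<lambda>C r. \<Union>c\<in>C. K #>\<^bsub>F\<^esub> frag_extend (\<lambda>(p, b). frag_of (p, b \<star>\<^bsub>B\<^esub> r)) c)\<rparr>)"


section \<open>The monoid \<open>\<V>(R)\<close>\<close>

text \<open>
  Isomorphism classes are formed among the modules whose elements have type \<^typ>\<open>nat \<Rightarrow> 'r\<close>.
  This type is large enough: a finitely generated projective module is isomorphic to \<open>e R\<^sup>n\<close>
  for some \<open>n\<close> and some idempotent matrix \<open>e\<close> over \<open>R\<close>. The module \<open>P\<close> whose class is taken
  may live on any type.
\<close>

definition iso_class ::
    "('r, 'c) ring_scheme \<Rightarrow> ('r, 'm, 'd) rmodule_scheme \<Rightarrow> ('r, nat \<Rightarrow> 'r) rmodule set" where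
  "iso_class R P = {M. fg_projective R M \<and> rmodule_iso R M P}"

text \<open>
  The operation of this monoid is written multiplicatively, following the record type, but it
  is \<open>[P] + [Q] = [P \<oplus> Q]\<close> (the unions below range over equal classes).
\<close>

definition V_monoid :: "('r, 'c) ring_scheme \<Rightarrow> ('r, nat \<Rightarrow> 'r) rmodule set monoid" where
  "V_monoid R =
    \<lparr>carrier = {iso_class R P | P :: ('r, nat \<Rightarrow> 'r) rmodule. fg_projective R P},
     monoid.mult = (\<lambda>x y. \<Union>P\<in>x. \<Union>Q\<in>y. iso_class R (direct_sum P Q)),
     one = iso_class R (zero_rmodule :: ('r, unit) rmodule)\<rparr>"

text \<open>\<open>[P] \<mapsto> [P \<otimes>\<^sub>S B]\<close>\<close>

definition V_tensor ::
    "('s, 'c) ring_scheme \<Rightarrow> ('r, 'd) ring_scheme \<Rightarrow> ('s, 'r, 'n, 'e) bimodule_scheme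
       \<Rightarrow> ('s, nat \<Rightarrow> 's) rmodule set \<Rightarrow> ('r, nat \<Rightarrow> 'r) rmodule set" where
  "V_tensor S R B x = (\<Union>P\<in>x. iso_class R (tensor_product S P B))"


section \<open>Commutative semigroups\<close>

definition semigroup_preorder :: "('a, 'c) monoid_scheme \<Rightarrow> 'a \<Rightarrow> 'a \<Rightarrow> bool" where
  "semigroup_preorder S x y \<longleftrightarrow> (\<exists>z\<in>carrier S. x \<otimes>\<^bsub>S\<^esub> z = y)"

definition semigroup_closure :: "('a, 'c) monoid_scheme \<Rightarrow> 'a set \<Rightarrow> 'a set" where
  "semigroup_closure S A = {x \<in> carrier S. \<exists>s\<in>A. semigroup_preorder S x s}"

inductive_set subsemigroup_generated :: "('a, 'c) monoid_scheme \<Rightarrow> 'a set \<Rightarrow> 'a set"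
  for S and A where
  incl: "a \<in> A \<Longrightarrow> a \<in> subsemigroup_generated S A"
| mult: "\<lbrakk>a \<in> subsemigroup_generated S A; b \<in> subsemigroup_generated S A\<rbrakk>
          \<Longrightarrow> a \<otimes>\<^bsub>S\<^esub> b \<in> subsemigroup_generated S A"

end

theory Submission
  imports Defs
begin

text \<open>
  Write \<open>S = \<alpha>R\<alpha>\<close> and \<open>B = \<alpha>R\<close>. The reason behind the theorem is that \<open>P \<mapsto> P \<otimes>\<^sub>S B\<close> has a concrete
  inverse, the corner functor \<open>M \<mapsto> M\<alpha>\<close>: finitely generated projective \<open>S\<close>-modules correspond
  to those finitely generated projective \<open>R\<close>-modules that are generated by their corner \<open>M\<alpha>\<close>.

  Everything is expressed with dual bases. A right \<open>R\<close>-module \<open>M\<close> is finitely generated projective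
  if and only if there are finitely many \<open>x\<^sub>i \<in> M\<close> and \<open>R\<close>-linear forms \<open>\<phi>\<^sub>i : M \<rightarrow> R\<close> such that
  \<open>m = \<Sum>\<^sub>i x\<^sub>i \<phi>\<^sub>i(m)\<close> for all \<open>m\<close> (\<open>fg_projective_iff_dual_basis\<close>). The forms take values in \<open>R\<close>
  itself, and not merely in its unitization, because \<open>M = MR\<close>. If all \<open>x\<^sub>i\<close> can be chosen in \<open>M\<alpha>\<close>,
  the module is called \<open>corner_generated\<close>. For such modules the following hold.

  \<^item> A homomorphism \<open>h : M\<alpha> \<rightarrow> N\<alpha>\<close> of \<open>S\<close>-modules extends uniquely to \<open>M \<rightarrow> N\<close>, by
    \<open>m \<mapsto> \<Sum>\<^sub>i h(x\<^sub>i) \<phi>\<^sub>i(m)\<close>. Hence \<open>M\<alpha> \<cong> N\<alpha>\<close> implies \<open>M \<cong> N\<close> (\<open>corner_reflects_iso\<close>).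

  \<^item> If \<open>P\<close> is finitely generated projective over \<open>S\<close>, then \<open>P \<otimes>\<^sub>S B\<close> is corner generated and
    \<open>p \<mapsto> p \<otimes> \<alpha>\<close> identifies \<open>P\<close> with its corner (\<open>tensor_corner\<close>).

  So a corner generated \<open>N\<close> with \<open>N\<alpha> \<cong> P\<close> represents the image of \<open>[P]\<close>, whatever
  its construction (\<open>V_tensor_iso_class\<close>). Additivity follows because taking corners commutes with
  direct sums, injectivity because isomorphic modules have isomorphic corners, and the image
  consists of the classes of all corner generated modules. Finally, a dual basis of \<open>M\<close> with \<open>n\<close>
  elements in \<open>M\<alpha>\<close> is the same as a presentation of \<open>M\<close> as a direct summand of \<open>B\<^sup>n\<close>, which
  identifies the image with the closure of the subsemigroup generated by \<open>[B]\<close>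
  (\<open>closure_multiples\<close>).
\<close>

section \<open>Right modules and their homomorphisms\<close>

text \<open>
  The module axioms as a locale, over the group locale of the underlying group, so that products
  \<open>\<Otimes>\<close> in \<open>M\<close> are the sums of module elements.
\<close>

locale rmodule = comm_group M for R and M (structure) +
  assumes ract_closed [simp]: "\<lbrakk>x \<in> carrier M; r \<in> carrier R\<rbrakk> \<Longrightarrow> x \<star> r \<in> carrier M"
    and ract_mult: "\<lbrakk>x \<in> carrier M; y \<in> carrier M; r \<in> carrier R\<rbrakk>
          \<Longrightarrow> (x \<otimes> y) \<star> r = (x \<star> r) \<otimes> (y \<star> r)"
    and ract_add: "\<lbrakk>x \<in> carrier M; r \<in> carrier R; s \<in> carrier R\<rbrakk>
          \<Longrightarrow> x \<star> (r \<oplus>\<^bsub>R\<^esub> s) = (x \<star> r) \<otimes> (x \<star> s)"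
    and ract_ract: "\<lbrakk>x \<in> carrier M; r \<in> carrier R; s \<in> carrier R\<rbrakk>
          \<Longrightarrow> x \<star> (r \<otimes>\<^bsub>R\<^esub> s) = (x \<star> r) \<star> s"

lemma right_module_iff_rmodule: "right_module R M \<longleftrightarrow> rmodule R M"
  unfolding right_module_def rmodule_def rmodule_axioms_def by blast

lemma (in rmodule) ract_one [simp]:
  assumes "r \<in> carrier R" shows "\<one> \<star> r = \<one>"
proof -
  have "(\<one> \<star> r) \<otimes> (\<one> \<star> r) = \<one> \<star> r"
    using ract_mult[of \<one> \<one> r] assms by simp
  then show ?thesis using assms by simp
qed

lemma (in rmodule) ract_hom: "r \<in> carrier R \<Longrightarrow> (\<lambda>x. x \<star> r) \<in> hom M M"
  by (rule homI) (auto simp: ract_mult)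

lemma (in rmodule) ract_inv:
  assumes "r \<in> carrier R" "x \<in> carrier M" shows "(inv x) \<star> r = inv (x \<star> r)"
  using group_hom.hom_inv[of M M "\<lambda>x. x \<star> r" x] ract_hom[OF assms(1)] assms
  by (simp add: group_hom_def group_hom_axioms_def is_group)

lemma (in rmodule) ract_zero:
  assumes "rng R" "x \<in> carrier M" shows "x \<star> \<zero>\<^bsub>R\<^esub> = \<one>"
proof -
  interpret R: rng R by fact
  have "(x \<star> \<zero>\<^bsub>R\<^esub>) \<otimes> (x \<star> \<zero>\<^bsub>R\<^esub>) = x \<star> \<zero>\<^bsub>R\<^esub>"
    using ract_add[of x "\<zero>\<^bsub>R\<^esub>" "\<zero>\<^bsub>R\<^esub>"] assms by simp
  then show ?thesis using assms by simp
qed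

lemma (in comm_monoid) hom_finprod:
  assumes "h \<in> hom H G" "comm_monoid H" "h \<one>\<^bsub>H\<^esub> = \<one>" "f \<in> I \<rightarrow> carrier H"
  shows "h (finprod H f I) = finprod G (\<lambda>i. h (f i)) I"
proof -
  interpret H: comm_monoid H by fact
  show ?thesis
    using assms(4)
  proof (induction I rule: infinite_finite_induct)
    case (insert i I)
    then have "f \<in> I \<rightarrow> carrier H" "f i \<in> carrier H" by auto
    moreover have "(\<lambda>i. h (f i)) \<in> insert i I \<rightarrow> carrier G"
      using insert.prems assms(1) by (auto simp: hom_def)
    ultimately show ?case
      using insert hom_mult[OF assms(1), of "f i" "finprod H f I"] by (auto simp: Pi_iff)
  qed (use assms(3) in auto)
qed

lemma rmodule_homI:
  assumes "\<And>x. x \<in> carrier M \<Longrightarrow> f x \<in> carrier N"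
    and "\<And>x y. \<lbrakk>x \<in> carrier M; y \<in> carrier M\<rbrakk> \<Longrightarrow> f (x \<otimes>\<^bsub>M\<^esub> y) = f x \<otimes>\<^bsub>N\<^esub> f y"
    and "\<And>x r. \<lbrakk>x \<in> carrier M; r \<in> carrier R\<rbrakk> \<Longrightarrow> f (x \<star>\<^bsub>M\<^esub> r) = f x \<star>\<^bsub>N\<^esub> r"
  shows "f \<in> rmodule_hom R M N"
  using assms by (auto simp: rmodule_hom_def hom_def)

lemma rmodule_homD:
  assumes "f \<in> rmodule_hom R M N"
  shows "f \<in> hom M N"
    and "x \<in> carrier M \<Longrightarrow> f x \<in> carrier N"
    and "\<lbrakk>x \<in> carrier M; y \<in> carrier M\<rbrakk> \<Longrightarrow> f (x \<otimes>\<^bsub>M\<^esub> y) = f x \<otimes>\<^bsub>N\<^esub> f y"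
    and "\<lbrakk>x \<in> carrier M; r \<in> carrier R\<rbrakk> \<Longrightarrow> f (x \<star>\<^bsub>M\<^esub> r) = f x \<star>\<^bsub>N\<^esub> r"
  using assms by (auto simp: rmodule_hom_def hom_def)

lemma rmodule_hom_one:
  assumes "f \<in> rmodule_hom R M N" "rmodule R M" "rmodule R N"
  shows "f \<one>\<^bsub>M\<^esub> = \<one>\<^bsub>N\<^esub>"
  using assms by (meson hom_one rmodule_homD(1) rmodule_def comm_group_def)

lemma rmodule_hom_finprod:
  assumes "f \<in> rmodule_hom R M N" "rmodule R M" "rmodule R N" "g \<in> I \<rightarrow> carrier M"
  shows "f (finprod M g I) = finprod N (\<lambda>i. f (g i)) I"
proof -
  interpret M: rmodule R M by fact
  interpret N: rmodule R N by fact
  show ?thesis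
    using assms rmodule_hom_one[OF assms(1-3)] rmodule_homD(1)[OF assms(1)]
    by (intro N.hom_finprod) (auto intro: M.comm_monoid_axioms)
qed

lemma rmodule_hom_compose:
  assumes "f \<in> rmodule_hom R M N" "g \<in> rmodule_hom R N L"
  shows "(\<lambda>x. g (f x)) \<in> rmodule_hom R M L"
  by (rule rmodule_homI) (simp_all add: rmodule_homD[OF assms(1)] rmodule_homD[OF assms(2)])

lemma rmodule_isoI:
  assumes f: "f \<in> rmodule_hom R M N"
    and "\<And>y. y \<in> carrier N \<Longrightarrow> g y \<in> carrier M"
    and "\<And>x. x \<in> carrier M \<Longrightarrow> g (f x) = x"
    and "\<And>y. y \<in> carrier N \<Longrightarrow> f (g y) = y"
  shows "rmodule_iso R M N"
proof -
  have "bij_betw f (carrier M) (carrier N)"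
    using assms(2-4) rmodule_homD(2)[OF f] by (intro bij_betwI[where g = g]) auto
  then show ?thesis using f by (auto simp: rmodule_iso_def)
qed

lemma rmodule_isoE:
  assumes "rmodule_iso R M N" "rmodule R M"
  obtains f g where "f \<in> rmodule_hom R M N" "g \<in> rmodule_hom R N M"
    "\<And>x. x \<in> carrier M \<Longrightarrow> g (f x) = x" "\<And>y. y \<in> carrier N \<Longrightarrow> f (g y) = y"
proof -
  interpret M: rmodule R M by fact
  obtain f where f: "f \<in> rmodule_hom R M N" and bij: "bij_betw f (carrier M) (carrier N)"
    using assms by (auto simp: rmodule_iso_def)
  define g where "g = inv_into (carrier M) f"
  have gf: "g (f x) = x" if "x \<in> carrier M" for x
    using bij that by (simp add: g_def bij_betw_inv_into_left)
  have fg: "f (g y) = y" if "y \<in> carrier N" for y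
    using bij that by (simp add: g_def bij_betw_inv_into_right)
  have gc: "g y \<in> carrier M" if "y \<in> carrier N" for y
    using bij that by (metis bij_betw_def g_def inv_into_into)
  have "g \<in> rmodule_hom R N M"
  proof (rule rmodule_homI)
    show "g (x \<otimes>\<^bsub>N\<^esub> y) = g x \<otimes>\<^bsub>M\<^esub> g y" if "x \<in> carrier N" "y \<in> carrier N" for x y
      using gf[of "g x \<otimes>\<^bsub>M\<^esub> g y"] that gc fg rmodule_homD(3)[OF f] by simp
    show "g (x \<star>\<^bsub>N\<^esub> r) = g x \<star>\<^bsub>M\<^esub> r" if "x \<in> carrier N" "r \<in> carrier R" for x r
      using gf[of "g x \<star>\<^bsub>M\<^esub> r"] that gc fg rmodule_homD(4)[OF f] by simp
  qed (rule gc)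
  then show thesis using f gf fg that by blast
qed

lemma rmodule_iso_refl: "rmodule_iso R M M"
  by (rule rmodule_isoI[where f = id and g = id]) (auto intro: rmodule_homI)

lemma rmodule_iso_sym:
  assumes "rmodule_iso R M N" "rmodule R M" shows "rmodule_iso R N M"
proof -
  obtain f g where f: "f \<in> rmodule_hom R M N" and g: "g \<in> rmodule_hom R N M"
    and "\<And>x. x \<in> carrier M \<Longrightarrow> g (f x) = x" "\<And>y. y \<in> carrier N \<Longrightarrow> f (g y) = y"
    using rmodule_isoE[OF assms] by blast
  then show ?thesis by (intro rmodule_isoI[OF g, of f] rmodule_homD(2)[OF f])
qed

lemma rmodule_iso_trans:
  assumes "rmodule_iso R M N" "rmodule_iso R N L" shows "rmodule_iso R M L"
proof -
  obtain f g where "f \<in> rmodule_hom R M N" "bij_betw f (carrier M) (carrier N)"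
    "g \<in> rmodule_hom R N L" "bij_betw g (carrier N) (carrier L)"
    using assms by (auto simp: rmodule_iso_def)
  then show ?thesis
    unfolding rmodule_iso_def
    by (intro bexI[of _ "\<lambda>x. g (f x)"])
      (auto intro: rmodule_hom_compose dest: bij_betw_trans simp: o_def)
qed

section \<open>Direct sums, submodules and the regular module\<close>

lemma direct_sum_simps [simp]:
  "carrier (direct_sum M N) = carrier M \<times> carrier N"
  "(x, y) \<otimes>\<^bsub>direct_sum M N\<^esub> (x', y') = (x \<otimes>\<^bsub>M\<^esub> x', y \<otimes>\<^bsub>N\<^esub> y')"
  "\<one>\<^bsub>direct_sum M N\<^esub> = (\<one>\<^bsub>M\<^esub>, \<one>\<^bsub>N\<^esub>)"
  "(x, y) \<star>\<^bsub>direct_sum M N\<^esub> r = (x \<star>\<^bsub>M\<^esub> r, y \<star>\<^bsub>N\<^esub> r)"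
  by (simp_all add: direct_sum_def)

lemma rmodule_direct_sum:
  assumes "rmodule R M" "rmodule R N" shows "rmodule R (direct_sum M N)"
proof -
  interpret M: rmodule R M by fact
  interpret N: rmodule R N by fact
  have "comm_group (direct_sum M N)"
    by (rule comm_groupI) (auto simp: M.m_ac N.m_ac)
  then show ?thesis
    by (rule rmodule.intro; unfold_locales)
      (auto simp: M.ract_mult N.ract_mult M.ract_add N.ract_add M.ract_ract N.ract_ract)
qed

lemma direct_sum_homs:
  assumes "rmodule R M" "rmodule R N"
  shows "fst \<in> rmodule_hom R (direct_sum M N) M"
    and "snd \<in> rmodule_hom R (direct_sum M N) N"
    and "(\<lambda>x. (x, \<one>\<^bsub>N\<^esub>)) \<in> rmodule_hom R M (direct_sum M N)"
    and "(\<lambda>y. (\<one>\<^bsub>M\<^esub>, y)) \<in> rmodule_hom R N (direct_sum M N)"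
proof -
  interpret M: rmodule R M by fact
  interpret N: rmodule R N by fact
  show "fst \<in> rmodule_hom R (direct_sum M N) M" "snd \<in> rmodule_hom R (direct_sum M N) N"
    "(\<lambda>x. (x, \<one>\<^bsub>N\<^esub>)) \<in> rmodule_hom R M (direct_sum M N)"
    "(\<lambda>y. (\<one>\<^bsub>M\<^esub>, y)) \<in> rmodule_hom R N (direct_sum M N)"
    by (auto intro!: rmodule_homI)
qed

lemma direct_sum_iso_cong:
  assumes "rmodule_iso R M M'" "rmodule_iso R N N'"
  shows "rmodule_iso R (direct_sum M N) (direct_sum M' N')"
proof -
  obtain f g where f: "f \<in> rmodule_hom R M M'" "bij_betw f (carrier M) (carrier M')"
    and g: "g \<in> rmodule_hom R N N'" "bij_betw g (carrier N) (carrier N')"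
    using assms by (auto simp: rmodule_iso_def)
  have "map_prod f g \<in> rmodule_hom R (direct_sum M N) (direct_sum M' N')"
    by (rule rmodule_homI) (auto simp: rmodule_homD[OF f(1)] rmodule_homD[OF g(1)])
  moreover have "bij_betw (map_prod f g) (carrier (direct_sum M N)) (carrier (direct_sum M' N'))"
    using bij_betw_map_prod[OF f(2) g(2)] by simp
  ultimately show ?thesis by (auto simp: rmodule_iso_def)
qed

definition rmodule_on :: "('r, 'm, 'd) rmodule_scheme \<Rightarrow> 'm set \<Rightarrow> ('r, 'm) rmodule" where
  "rmodule_on M H = \<lparr>carrier = H, monoid.mult = monoid.mult M, one = one M, ract = ract M\<rparr>"

lemma rmodule_on_simps [simp]:
  "carrier (rmodule_on M H) = H" "monoid.mult (rmodule_on M H) = monoid.mult M"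
  "one (rmodule_on M H) = one M" "ract (rmodule_on M H) = ract M"
  by (simp_all add: rmodule_on_def)

lemma (in rmodule) rmodule_on:
  assumes "subgroup H M" "\<And>x r. \<lbrakk>x \<in> H; r \<in> carrier R\<rbrakk> \<Longrightarrow> x \<star> r \<in> H"
  shows "rmodule R (rmodule_on M H)"
proof -
  have sub: "x \<in> carrier M" if "x \<in> H" for x
    using subgroup.subset[OF assms(1)] that by blast
  have "comm_group (rmodule_on M H)"
    by (rule comm_groupI)
      (auto simp: sub m_ac subgroup.m_closed[OF assms(1)] subgroup.one_closed[OF assms(1)]
        intro!: bexI[where x = "inv _"] subgroup.m_inv_closed[OF assms(1)])
  then show ?thesis
    by (rule rmodule.intro; unfold_locales)
      (auto simp: sub ract_mult ract_add ract_ract assms(2))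
qed

text \<open>
  A split epimorphism of modules exhibits its target as a direct summand of its source, with
  the kernel as complement.
\<close>

lemma split_epi_direct_sum:
  assumes L: "rmodule R L" and M: "rmodule R M"
    and p: "p \<in> rmodule_hom R L M" and s: "s \<in> rmodule_hom R M L"
    and ps: "\<And>x. x \<in> carrier M \<Longrightarrow> p (s x) = x"
  defines "K \<equiv> rmodule_on L {y \<in> carrier L. p y = \<one>\<^bsub>M\<^esub>}"
  shows "rmodule R K" and "rmodule_iso R (direct_sum M K) L"
proof -
  interpret L: rmodule R L by fact
  interpret M: rmodule R M by fact
  interpret p: group_hom L M p
    using rmodule_homD(1)[OF p]
    by (simp add: group_hom_def group_hom_axioms_def L.is_group M.is_group)
  note pD = rmodule_homD[OF p] and sD = rmodule_homD[OF s]
  have "subgroup (kernel L M p) L" by (rule p.subgroup_kernel)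
  then show K: "rmodule R K"
    unfolding K_def kernel_def by (rule L.rmodule_on) (simp add: pD)
  show "rmodule_iso R (direct_sum M K) L"
  proof (rule rmodule_isoI[where f = "\<lambda>(x, y). s x \<otimes>\<^bsub>L\<^esub> y"
        and g = "\<lambda>z. (p z, inv\<^bsub>L\<^esub> (s (p z)) \<otimes>\<^bsub>L\<^esub> z)"])
    show "(\<lambda>(x, y). s x \<otimes>\<^bsub>L\<^esub> y) \<in> rmodule_hom R (direct_sum M K) L"
      by (rule rmodule_homI) (auto simp: K_def sD L.m_ac L.ract_mult)
  qed (auto simp: K_def sD ps L.m_assoc[symmetric])
qed

definition regular_rmodule :: "('r, 'c) ring_scheme \<Rightarrow> ('r, 'r) rmodule" where
  "regular_rmodule R = \<lparr>carrier = carrier R, monoid.mult = ring.add R, one = ring.zero R,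
     ract = monoid.mult R\<rparr>"

lemma regular_rmodule_simps [simp]:
  "carrier (regular_rmodule R) = carrier R" "monoid.mult (regular_rmodule R) = ring.add R"
  "one (regular_rmodule R) = ring.zero R" "ract (regular_rmodule R) = monoid.mult R"
  by (simp_all add: regular_rmodule_def)

context rng begin

lemma r_null [simp]: "x \<in> carrier R \<Longrightarrow> x \<otimes> \<zero> = \<zero>"
  by (metis add.l_cancel_one' rng_m_closed rng_r_distr zero_closed)

lemma l_null [simp]: "x \<in> carrier R \<Longrightarrow> \<zero> \<otimes> x = \<zero>"
  by (metis add.l_cancel_one' rng_m_closed rng_l_distr zero_closed)

end

section \<open>Dual bases\<close>

definition dual_basis ::
    "('r, 'c) ring_scheme \<Rightarrow> ('r, 'm, 'd) rmodule_scheme \<Rightarrow> 'i set \<Rightarrow> ('i \<Rightarrow> 'm)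
       \<Rightarrow> ('i \<Rightarrow> 'm \<Rightarrow> 'r) \<Rightarrow> bool" where
  "dual_basis R M I x \<phi> \<longleftrightarrow>
     finite I \<and> x \<in> I \<rightarrow> carrier M \<and>
     (\<forall>i\<in>I. \<phi> i \<in> rmodule_hom R M (regular_rmodule R)) \<and>
     (\<forall>m\<in>carrier M. finprod M (\<lambda>i. x i \<star>\<^bsub>M\<^esub> \<phi> i m) I = m)"

text \<open>
  Recording a set \<open>C\<close> that contains the basis elements allows a uniform treatment of two cases:
  \<open>C = M\<close> describes all finitely generated projective modules, and \<open>C = M\<alpha>\<close> those that come from
  the corner.
\<close>

definition has_dual_basis_in ::
    "('r, 'c) ring_scheme \<Rightarrow> ('r, 'm, 'd) rmodule_scheme \<Rightarrow> 'm set \<Rightarrow> bool" where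
  "has_dual_basis_in R M C \<longleftrightarrow>
     (\<exists>(n :: nat) x \<phi>. dual_basis R M {..<n} x \<phi> \<and> x ` {..<n} \<subseteq> C)"

lemma dual_basisD:
  assumes "dual_basis R M I x \<phi>"
  shows "finite I" "i \<in> I \<Longrightarrow> x i \<in> carrier M" "i \<in> I \<Longrightarrow> \<phi> i \<in> rmodule_hom R M (regular_rmodule R)"
    "m \<in> carrier M \<Longrightarrow> finprod M (\<lambda>i. x i \<star>\<^bsub>M\<^esub> \<phi> i m) I = m"
  using assms by (auto simp: dual_basis_def)

lemma has_dual_basis_inI:
  assumes M: "rmodule R M" and db: "dual_basis R M I x \<phi>" and C: "x ` I \<subseteq> C"
  shows "has_dual_basis_in R M C"
proof -
  interpret M: rmodule R M by fact
  note D = dual_basisD[OF db]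
  obtain h where h: "bij_betw h {..<card I} I"
    using ex_bij_betw_nat_finite[OF D(1)] by (auto simp: atLeast0LessThan)
  then have hI: "h k \<in> I" if "k < card I" for k
    using that by (auto simp: bij_betw_def)
  have "finprod M (\<lambda>k. x (h k) \<star>\<^bsub>M\<^esub> \<phi> (h k) m) {..<card I} = m" if m: "m \<in> carrier M" for m
  proof -
    have "finprod M (\<lambda>i. x i \<star>\<^bsub>M\<^esub> \<phi> i m) (h ` {..<card I})
        = finprod M (\<lambda>k. x (h k) \<star>\<^bsub>M\<^esub> \<phi> (h k) m) {..<card I}"
      using h hI D m
      by (intro M.finprod_reindex) (auto simp: bij_betw_def rmodule_homD(2)[OF D(3), simplified])
    then show ?thesis using h D(4)[OF m] by (simp add: bij_betw_def)
  qed
  then have "dual_basis R M {..<card I} (x \<circ> h) (\<phi> \<circ> h)"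
    using D hI by (auto simp: dual_basis_def)
  moreover have "(x \<circ> h) ` {..<card I} \<subseteq> C"
    using C hI by auto
  ultimately show ?thesis unfolding has_dual_basis_in_def by blast
qed

text \<open>
  Any finite family of elements of \<open>N\<close> and linear forms on \<open>M\<close> defines a homomorphism
  \<open>M \<rightarrow> N\<close>. Extensions of homomorphisms and projections onto summands arise in this way.
\<close>

lemma finprod_ract_hom:
  assumes M: "rmodule R M" and N: "rmodule R N"
    and x: "\<And>i. i \<in> I \<Longrightarrow> x i \<in> carrier N"
    and \<phi>: "\<And>i. i \<in> I \<Longrightarrow> \<phi> i \<in> rmodule_hom R M (regular_rmodule R)"
  shows "(\<lambda>m. finprod N (\<lambda>i. x i \<star>\<^bsub>N\<^esub> \<phi> i m) I) \<in> rmodule_hom R M N"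
proof -
  interpret M: rmodule R M by fact
  interpret N: rmodule R N by fact
  note \<phi>D = rmodule_homD[OF \<phi>, simplified]
  have Pi: "(\<lambda>i. x i \<star>\<^bsub>N\<^esub> \<phi> i m) \<in> I \<rightarrow> carrier N" if "m \<in> carrier M" for m
    using that x \<phi>D by auto
  show ?thesis
  proof (rule rmodule_homI)
    fix m m' assume m: "m \<in> carrier M" "m' \<in> carrier M"
    have "finprod N (\<lambda>i. x i \<star>\<^bsub>N\<^esub> \<phi> i (m \<otimes>\<^bsub>M\<^esub> m')) I
        = finprod N (\<lambda>i. (x i \<star>\<^bsub>N\<^esub> \<phi> i m) \<otimes>\<^bsub>N\<^esub> (x i \<star>\<^bsub>N\<^esub> \<phi> i m')) I"
      using m x \<phi>D by (intro N.finprod_cong') (auto simp: N.ract_add)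
    then show "finprod N (\<lambda>i. x i \<star>\<^bsub>N\<^esub> \<phi> i (m \<otimes>\<^bsub>M\<^esub> m')) I
      = finprod N (\<lambda>i. x i \<star>\<^bsub>N\<^esub> \<phi> i m) I \<otimes>\<^bsub>N\<^esub> finprod N (\<lambda>i. x i \<star>\<^bsub>N\<^esub> \<phi> i m') I"
      using m Pi by (simp add: N.finprod_multf)
  next
    fix m r assume m: "m \<in> carrier M" and r: "r \<in> carrier R"
    have "finprod N (\<lambda>i. x i \<star>\<^bsub>N\<^esub> \<phi> i (m \<star>\<^bsub>M\<^esub> r)) I
        = finprod N (\<lambda>i. (x i \<star>\<^bsub>N\<^esub> \<phi> i m) \<star>\<^bsub>N\<^esub> r) I"
      using m r x \<phi>D by (intro N.finprod_cong') (auto simp: N.ract_ract)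
    also have "\<dots> = finprod N (\<lambda>i. x i \<star>\<^bsub>N\<^esub> \<phi> i m) I \<star>\<^bsub>N\<^esub> r"
      using N.ract_hom[OF r] Pi[OF m] r
      by (intro N.hom_finprod[symmetric]) (auto intro: N.comm_monoid_axioms)
    finally show "finprod N (\<lambda>i. x i \<star>\<^bsub>N\<^esub> \<phi> i (m \<star>\<^bsub>M\<^esub> r)) I
        = finprod N (\<lambda>i. x i \<star>\<^bsub>N\<^esub> \<phi> i m) I \<star>\<^bsub>N\<^esub> r" .
  qed (use Pi in auto)
qed

text \<open>
  The images \<open>p(x\<^sub>i)\<close> with the forms \<open>\<phi>\<^sub>i \<circ> s\<close> form a dual basis of a retract \<open>p : L \<rightarrow> M\<close> with
  section \<open>s\<close>.
\<close>

lemma has_dual_basis_in_retract: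
  assumes L: "rmodule R L" and M: "rmodule R M"
    and p: "p \<in> rmodule_hom R L M" and s: "s \<in> rmodule_hom R M L"
    and ps: "\<And>x. x \<in> carrier M \<Longrightarrow> p (s x) = x"
    and db: "has_dual_basis_in R L C" and C: "p ` (C \<inter> carrier L) \<subseteq> D"
  shows "has_dual_basis_in R M D"
proof -
  obtain n :: nat and x \<phi> where db: "dual_basis R L {..<n} x \<phi>" and x: "x ` {..<n} \<subseteq> C"
    using db by (auto simp: has_dual_basis_in_def)
  note B = dual_basisD[OF db] and pD = rmodule_homD[OF p] and sD = rmodule_homD[OF s]
  have "finprod M (\<lambda>i. p (x i) \<star>\<^bsub>M\<^esub> \<phi> i (s m)) {..<n} = m" if m: "m \<in> carrier M" for m
  proof -
    interpret M: rmodule R M by fact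
    interpret L: rmodule R L by fact
    note \<phi>D = rmodule_homD[OF B(3), simplified]
    have "m = p (finprod L (\<lambda>i. x i \<star>\<^bsub>L\<^esub> \<phi> i (s m)) {..<n})"
      using m by (simp add: B(4) sD ps)
    also have "\<dots> = finprod M (\<lambda>i. p (x i \<star>\<^bsub>L\<^esub> \<phi> i (s m))) {..<n}"
      using m B \<phi>D sD by (intro rmodule_hom_finprod[OF p L M]) auto
    also have "\<dots> = finprod M (\<lambda>i. p (x i) \<star>\<^bsub>M\<^esub> \<phi> i (s m)) {..<n}"
      using m B \<phi>D sD pD by (intro M.finprod_cong') auto
    finally show ?thesis by simp
  qed
  then have "dual_basis R M {..<n} (\<lambda>i. p (x i)) (\<lambda>i m. \<phi> i (s m))"
    using B(2) pD(2) rmodule_hom_compose[OF s B(3)] by (auto simp: dual_basis_def)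
  moreover have "(\<lambda>i. p (x i)) ` {..<n} \<subseteq> D"
    using x B(2) C by auto
  ultimately show ?thesis unfolding has_dual_basis_in_def by blast
qed

lemma has_dual_basis_in_iso:
  assumes "rmodule_iso R L M" "rmodule R L" "rmodule R M"
    and "has_dual_basis_in R L (carrier L)"
  shows "has_dual_basis_in R M (carrier M)"
proof -
  obtain f g where fg: "f \<in> rmodule_hom R L M" "g \<in> rmodule_hom R M L"
    "\<And>y. y \<in> carrier M \<Longrightarrow> f (g y) = y"
    using rmodule_isoE[OF assms(1,2)] by metis
  show ?thesis
    by (rule has_dual_basis_in_retract[OF assms(2,3) fg assms(4)])
      (use rmodule_homD(2)[OF fg(1)] in auto)
qed

lemma has_dual_basis_in_direct_sum:
  assumes M: "rmodule R M" and N: "rmodule R N"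
    and "has_dual_basis_in R M C" "has_dual_basis_in R N D"
    and "\<one>\<^bsub>M\<^esub> \<in> C" "\<one>\<^bsub>N\<^esub> \<in> D"
  shows "has_dual_basis_in R (direct_sum M N) (C \<times> D)"
proof -
  interpret M: rmodule R M by fact
  interpret N: rmodule R N by fact
  let ?S = "direct_sum M N"
  interpret S: rmodule R ?S using M N by (rule rmodule_direct_sum)
  note homs = direct_sum_homs[OF M N]
  obtain m :: nat and x \<phi> where db1: "dual_basis R M {..<m} x \<phi>" and x: "x ` {..<m} \<subseteq> C"
    using assms by (auto simp: has_dual_basis_in_def)
  obtain n :: nat and y \<psi> where db2: "dual_basis R N {..<n} y \<psi>" and y: "y ` {..<n} \<subseteq> D"
    using assms by (auto simp: has_dual_basis_in_def)
  note B1 = dual_basisD[OF db1] and B2 = dual_basisD[OF db2]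
  note \<phi> = rmodule_homD[OF B1(3), simplified] and \<psi> = rmodule_homD[OF B2(3), simplified]
  \<comment> \<open>The index set is the disjoint union of the two index sets; each basis is padded with zeros.\<close>
  define z where "z = case_sum (\<lambda>i. (x i, \<one>\<^bsub>N\<^esub>)) (\<lambda>j. (\<one>\<^bsub>M\<^esub>, y j))"
  define \<chi> where "\<chi> = case_sum (\<lambda>i w. \<phi> i (fst w)) (\<lambda>j w. \<psi> j (snd w))"
  have zc: "z k \<in> carrier ?S" if "k \<in> {..<m} <+> {..<n}" for k
    using that B1(2) B2(2) by (auto simp: z_def)
  have \<chi>c: "\<chi> k w \<in> carrier R" if "k \<in> {..<m} <+> {..<n}" "w \<in> carrier ?S" for k w
    using that \<phi>(2) \<psi>(2) by (auto simp: \<chi>_def)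
  have "finprod ?S (\<lambda>k. z k \<star>\<^bsub>?S\<^esub> \<chi> k w) ({..<m} <+> {..<n}) = w" if w: "w \<in> carrier ?S" for w
  proof -
    obtain a b where ab: "w = (a, b)" "a \<in> carrier M" "b \<in> carrier N" using w by auto
    let ?f = "\<lambda>k. z k \<star>\<^bsub>?S\<^esub> \<chi> k w"
    have fc: "?f \<in> {..<m} <+> {..<n} \<rightarrow> carrier ?S" using zc \<chi>c w by (intro Pi_I S.ract_closed)
    then have fc1: "?f \<in> Inl ` {..<m} \<rightarrow> carrier ?S" and fc2: "?f \<in> Inr ` {..<n} \<rightarrow> carrier ?S"
      by (auto simp: Plus_def)
    have "finprod ?S ?f (Inl ` {..<m}) = finprod ?S (\<lambda>i. (x i \<star>\<^bsub>M\<^esub> \<phi> i a, \<one>\<^bsub>N\<^esub>)) {..<m}"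
      using fc1 B1 \<phi> ab
      by (subst S.finprod_reindex) (auto simp: z_def \<chi>_def intro!: S.finprod_cong')
    also have "\<dots> = (finprod M (\<lambda>i. x i \<star>\<^bsub>M\<^esub> \<phi> i a) {..<m}, \<one>\<^bsub>N\<^esub>)"
      using B1 \<phi> ab by (intro rmodule_hom_finprod[OF homs(3) M S.rmodule_axioms, symmetric]) auto
    finally have 1: "finprod ?S ?f (Inl ` {..<m}) = (a, \<one>\<^bsub>N\<^esub>)"
      using B1 ab by simp
    have "finprod ?S ?f (Inr ` {..<n}) = finprod ?S (\<lambda>i. (\<one>\<^bsub>M\<^esub>, y i \<star>\<^bsub>N\<^esub> \<psi> i b)) {..<n}"
      using fc2 B2 \<psi> ab
      by (subst S.finprod_reindex) (auto simp: z_def \<chi>_def intro!: S.finprod_cong')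
    also have "\<dots> = (\<one>\<^bsub>M\<^esub>, finprod N (\<lambda>i. y i \<star>\<^bsub>N\<^esub> \<psi> i b) {..<n})"
      using B2 \<psi> ab by (intro rmodule_hom_finprod[OF homs(4) N S.rmodule_axioms, symmetric]) auto
    finally have 2: "finprod ?S ?f (Inr ` {..<n}) = (\<one>\<^bsub>M\<^esub>, b)"
      using B2 ab by simp
    have "finprod ?S ?f ({..<m} <+> {..<n})
        = finprod ?S ?f (Inl ` {..<m}) \<otimes>\<^bsub>?S\<^esub> finprod ?S ?f (Inr ` {..<n})"
      unfolding Plus_def using fc1 fc2 by (intro S.finprod_Un_disjoint) auto
    then show ?thesis unfolding 1 2 by (simp add: ab)
  qed
  then have "dual_basis R ?S ({..<m} <+> {..<n}) z \<chi>"
    using zc rmodule_hom_compose[OF homs(1) B1(3)] rmodule_hom_compose[OF homs(2) B2(3)]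
    unfolding dual_basis_def by (intro conjI ballI) (auto simp: \<chi>_def)
  moreover have "z ` ({..<m} <+> {..<n}) \<subseteq> C \<times> D"
    using x y assms(5,6) by (auto simp: z_def)
  ultimately show ?thesis by (rule has_dual_basis_inI[OF S.rmodule_axioms])
qed

section \<open>Free modules over the unitization\<close>

lemma unitization_simps [simp]:
  "carrier (unitization R) = UNIV \<times> carrier R"
  "\<zero>\<^bsub>unitization R\<^esub> = (0, \<zero>\<^bsub>R\<^esub>)"
  "(m, x) \<oplus>\<^bsub>unitization R\<^esub> (n, y) = (m + n, x \<oplus>\<^bsub>R\<^esub> y)"
  by (simp_all add: unitization_def)

lemma free_rmodule_simps [simp]:
  "monoid.mult (free_rmodule R X) = (\<lambda>f g x. f x \<oplus>\<^bsub>unitization R\<^esub> g x)"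
  "\<one>\<^bsub>free_rmodule R X\<^esub> = (\<lambda>_. (0, \<zero>\<^bsub>R\<^esub>))"
  "ract (free_rmodule R X) = (\<lambda>f r x. f x \<otimes>\<^bsub>unitization R\<^esub> (0, r))"
  by (simp_all add: free_rmodule_def)

lemma free_rmodule_carrier:
  "f \<in> carrier (free_rmodule R X) \<longleftrightarrow>
     (\<forall>x. snd (f x) \<in> carrier R) \<and> finite {x. f x \<noteq> (0, \<zero>\<^bsub>R\<^esub>)} \<and> {x. f x \<noteq> (0, \<zero>\<^bsub>R\<^esub>)} \<subseteq> X"
  by (auto simp: free_rmodule_def mem_Times_iff)

context rng begin

lemma add_pow_0 [simp]: "[(0 :: int)] \<cdot>\<^bsub>R\<^esub> a = \<zero>"
  by (simp add: add_pow_def)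

text \<open>
  The action of \<open>R\<close> on a free module multiplies by elements \<open>(0, r)\<close> of the ideal \<open>R\<close> of its
  unitization. The integer component of every such product vanishes.
\<close>

lemma unitization_mult_ideal:
  "r \<in> carrier R \<Longrightarrow> a \<in> carrier R \<Longrightarrow>
     (m, a) \<otimes>\<^bsub>unitization R\<^esub> (0, r) = (0, [m] \<cdot>\<^bsub>R\<^esub> r \<oplus> a \<otimes> r)"
  by (simp add: unitization_def)

lemma unitization_mult_ideal':
  "r \<in> carrier R \<Longrightarrow> snd u \<in> carrier R \<Longrightarrow>
     u \<otimes>\<^bsub>unitization R\<^esub> (0, r) = (0, [fst u] \<cdot>\<^bsub>R\<^esub> r \<oplus> snd u \<otimes> r)"
  by (cases u) (simp add: unitization_mult_ideal)

lemma unitization_add: "u \<oplus>\<^bsub>unitization R\<^esub> v = (fst u + fst v, snd u \<oplus> snd v)"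
  by (cases u; cases v) simp

lemma add_pow_r_distr:
  fixes m :: int
  assumes "r \<in> carrier R" "s \<in> carrier R" shows "([m] \<cdot>\<^bsub>R\<^esub> r) \<otimes> s = [m] \<cdot>\<^bsub>R\<^esub> (r \<otimes> s)"
proof -
  have "(\<lambda>r. r \<otimes> s) \<in> hom (add_monoid R) (add_monoid R)"
    using assms by (auto intro!: homI simp: rng_m_closed rng_l_distr)
  then show ?thesis
    unfolding add_pow_def using assms by (intro hom_int_pow) (auto intro: add.is_group)
qed

lemma rmodule_free: "rmodule R (free_rmodule R X)"
proof -
  \<comment> \<open>Pointwise operations that preserve zero preserve finite support inside \<open>X\<close>.\<close>
  have fin: "finite {x. h (f x) (g x) \<noteq> (0, \<zero>)} \<and> {x. h (f x) (g x) \<noteq> (0, \<zero>)} \<subseteq> X"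
    if "f \<in> carrier (free_rmodule R X)" "g \<in> carrier (free_rmodule R X)"
      "h (0, \<zero>) (0, \<zero>) = (0, \<zero>)" for f g and h :: "int \<times> 'a \<Rightarrow> int \<times> 'a \<Rightarrow> int \<times> 'a"
  proof -
    have "{x. h (f x) (g x) \<noteq> (0, \<zero>)} \<subseteq> {x. f x \<noteq> (0, \<zero>)} \<union> {x. g x \<noteq> (0, \<zero>)}"
      using that(3) by auto
    then show ?thesis
      using that(1,2) unfolding free_rmodule_carrier by (meson finite_UnI finite_subset le_sup_iff order_trans)
  qed
  have grp: "comm_group (free_rmodule R X)"
  proof (rule comm_groupI)
    fix f assume f: "f \<in> carrier (free_rmodule R X)"
    let ?g = "\<lambda>x. (- fst (f x), \<ominus> snd (f x))"
    have "?g \<in> carrier (free_rmodule R X)"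
      using f fin[OF f f, of "\<lambda>u _. (- fst u, \<ominus> snd u)"] by (auto simp: free_rmodule_carrier)
    moreover have "?g \<otimes>\<^bsub>free_rmodule R X\<^esub> f = \<one>\<^bsub>free_rmodule R X\<^esub>"
      using f by (auto simp: free_rmodule_carrier unitization_add l_neg)
    ultimately show "\<exists>g\<in>carrier (free_rmodule R X). g \<otimes>\<^bsub>free_rmodule R X\<^esub> f = \<one>\<^bsub>free_rmodule R X\<^esub>"
      by blast
  next
    fix f g assume fg: "f \<in> carrier (free_rmodule R X)" "g \<in> carrier (free_rmodule R X)"
    then show "f \<otimes>\<^bsub>free_rmodule R X\<^esub> g \<in> carrier (free_rmodule R X)"
      using fin[OF fg, of "\<lambda>u v. u \<oplus>\<^bsub>unitization R\<^esub> v"]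
      by (auto simp: free_rmodule_carrier unitization_add)
  qed (auto simp: free_rmodule_carrier unitization_add a_ac add.m_assoc)
  moreover have "f \<star>\<^bsub>free_rmodule R X\<^esub> r \<in> carrier (free_rmodule R X)"
    if "f \<in> carrier (free_rmodule R X)" "r \<in> carrier R" for f r
    using that fin[OF that(1,1), of "\<lambda>u _. u \<otimes>\<^bsub>unitization R\<^esub> (0, r)"]
    by (auto simp: free_rmodule_carrier unitization_mult_ideal' rng_m_closed)
  ultimately show ?thesis
    by (intro rmodule.intro rmodule_axioms.intro)
      (auto simp: free_rmodule_carrier unitization_mult_ideal' unitization_add
        rng_m_closed rng_l_distr rng_r_distr rng_m_assoc add.int_pow_mult
        add.int_pow_distrib add_pow_r_distr a_ac)
qed

definition free_gen :: "'x \<Rightarrow> 'x \<Rightarrow> int \<times> 'a" where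
  "free_gen x = (\<lambda>y. if y = x then (1, \<zero>) else (0, \<zero>))"

lemma free_gen_closed: "x \<in> X \<Longrightarrow> free_gen x \<in> carrier (free_rmodule R X)"
  by (auto simp: free_rmodule_carrier free_gen_def)

lemma free_gen_combination:
  assumes "finite Y" "Y \<subseteq> X" "g \<in> Y \<rightarrow> carrier R"
  shows "finprod (free_rmodule R X) (\<lambda>y. free_gen y \<star>\<^bsub>free_rmodule R X\<^esub> g y) Y
     = (\<lambda>z. if z \<in> Y then (0, g z) else (0, \<zero>))"
proof -
  interpret F: rmodule R "free_rmodule R X" by (rule rmodule_free)
  show ?thesis
    using assms
  proof (induction Y rule: finite_induct)
    case (insert y Y)
    have "free_gen i \<star>\<^bsub>free_rmodule R X\<^esub> g i \<in> carrier (free_rmodule R X)" if "i \<in> insert y Y" for i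
      using that insert.prems by (intro F.ract_closed free_gen_closed) auto
    then show ?case
      using insert by (auto simp: fun_eq_iff free_gen_def unitization_mult_ideal unitization_add Pi_iff)
  qed auto
qed

end

section \<open>Finitely generated projective modules have dual bases\<close>

text \<open>
  A dual basis may list the same element several times. Adding up the forms that belong to equal
  elements indexes it by a subset of the module itself. This is what makes the free module
  in the definition of projectivity, whose generators form a set of elements of the type of \<open>M\<close>,
  large enough even if that type is finite.
\<close>

lemma (in rmodule) dual_basis_distinct:
  assumes R: "rng R" and "finite I" "x \<in> I \<rightarrow> carrier M"
    and "\<And>i. i \<in> I \<Longrightarrow> \<phi> i \<in> rmodule_hom R M (regular_rmodule R)"
  shows "\<exists>\<psi>. (\<forall>y\<in>x ` I. \<psi> y \<in> rmodule_hom R M (regular_rmodule R)) \<and>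
    (\<forall>m\<in>carrier M. finprod M (\<lambda>y. y \<star> \<psi> y m) (x ` I) = finprod M (\<lambda>i. x i \<star> \<phi> i m) I)"
  using assms(2-)
proof (induction I rule: finite_induct)
  case (insert i I)
  interpret R: rng R by fact
  have "x \<in> I \<rightarrow> carrier M" "\<And>j. j \<in> I \<Longrightarrow> \<phi> j \<in> rmodule_hom R M (regular_rmodule R)"
    using insert.prems by auto
  from insert.IH[OF this]
  obtain \<psi> where \<psi>: "\<And>y. y \<in> x ` I \<Longrightarrow> \<psi> y \<in> rmodule_hom R M (regular_rmodule R)"
    "\<And>m. m \<in> carrier M \<Longrightarrow> finprod M (\<lambda>y. y \<star> \<psi> y m) (x ` I) = finprod M (\<lambda>i. x i \<star> \<phi> i m) I"
    by blast
  note \<phi>D = rmodule_homD[OF insert.prems(2), simplified]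
  note \<psi>D = rmodule_homD[OF \<psi>(1), simplified]
  have xc: "x j \<in> carrier M" if "j \<in> insert i I" for j
    using insert.prems that by auto
  have I: "(\<lambda>j. x j \<star> \<phi> j m) \<in> I \<rightarrow> carrier M" "x i \<star> \<phi> i m \<in> carrier M"
    if "m \<in> carrier M" for m
    using that xc \<phi>D by auto
  show ?case
  proof (cases "x i \<in> x ` I")
    case False
    let ?\<psi> = "\<psi>(x i := \<phi> i)"
    have "finprod M (\<lambda>y. y \<star> ?\<psi> y m) (x ` insert i I) = finprod M (\<lambda>i. x i \<star> \<phi> i m) (insert i I)"
      if m: "m \<in> carrier M" for m
    proof -
      have upd: "?\<psi> y = \<psi> y" if "y \<in> x ` I" for y
        using that False by (metis fun_upd_other)
      have "finprod M (\<lambda>y. y \<star> ?\<psi> y m) (x ` I) = finprod M (\<lambda>y. y \<star> \<psi> y m) (x ` I)"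
        using m xc \<psi>D(2) by (intro finprod_cong') (auto simp: upd simp del: fun_upd_apply)
      moreover have "(\<lambda>y. y \<star> ?\<psi> y m) \<in> x ` I \<rightarrow> carrier M"
        using m xc \<psi>D(2) by (auto simp: upd simp del: fun_upd_apply)
      ultimately show ?thesis
        using m False insert.hyps I[OF m] \<psi>(2)[OF m] by simp
    qed
    then show ?thesis
      using \<psi>(1) insert.prems by (intro exI[of _ ?\<psi>]) auto
  next
    case True
    let ?\<psi> = "\<psi>(x i := \<lambda>m. \<psi> (x i) m \<oplus>\<^bsub>R\<^esub> \<phi> i m)"
    let ?J = "x ` I - {x i}"
    have img: "x ` insert i I = insert (x i) ?J" "x ` I = insert (x i) ?J" using True by auto
    have "finprod M (\<lambda>y. y \<star> ?\<psi> y m) (x ` insert i I) = finprod M (\<lambda>i. x i \<star> \<phi> i m) (insert i I)"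
      if m: "m \<in> carrier M" for m
    proof -
      have c: "(\<lambda>y. y \<star> \<psi> y m) \<in> x ` I \<rightarrow> carrier M" "(\<lambda>y. y \<star> ?\<psi> y m) \<in> ?J \<rightarrow> carrier M"
        "x i \<star> \<psi> (x i) m \<in> carrier M" "\<psi> (x i) m \<in> carrier R" "\<phi> i m \<in> carrier R" "x i \<in> carrier M"
        using m True xc \<psi>D \<phi>D by auto
      have eq: "finprod M (\<lambda>y. y \<star> ?\<psi> y m) ?J = finprod M (\<lambda>y. y \<star> \<psi> y m) ?J"
        using m xc \<psi>D by (intro finprod_cong') auto
      let ?T = "finprod M (\<lambda>y. y \<star> \<psi> y m) ?J"
      have T: "?T \<in> carrier M" using c(1) by (intro finprod_closed) auto
      have "finprod M (\<lambda>y. y \<star> ?\<psi> y m) (x ` insert i I)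
          = x i \<star> ?\<psi> (x i) m \<otimes> finprod M (\<lambda>y. y \<star> ?\<psi> y m) ?J"
        unfolding img(1) using c insert.hyps(1) by (intro finprod_insert) (simp_all add: ract_add)
      also have "\<dots> = (x i \<star> \<psi> (x i) m \<otimes> x i \<star> \<phi> i m) \<otimes> ?T"
        unfolding eq using c by (simp add: ract_add)
      also have "\<dots> = x i \<star> \<phi> i m \<otimes> (x i \<star> \<psi> (x i) m \<otimes> ?T)"
        using c T by (simp add: m_ac)
      also have "x i \<star> \<psi> (x i) m \<otimes> ?T = finprod M (\<lambda>y. y \<star> \<psi> y m) (insert (x i) ?J)"
        using c insert.hyps(1) by (intro finprod_insert[symmetric]) auto
      also have "insert (x i) ?J = x ` I" by (rule img(2)[symmetric])
      also have "x i \<star> \<phi> i m \<otimes> finprod M (\<lambda>y. y \<star> \<psi> y m) (x ` I) = finprod M (\<lambda>i. x i \<star> \<phi> i m) (insert i I)"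
        using m insert.hyps I[OF m] \<psi>(2)[OF m] by simp
      finally show ?thesis .
    qed
    moreover have "(\<lambda>m. \<psi> (x i) m \<oplus>\<^bsub>R\<^esub> \<phi> i m) \<in> rmodule_hom R M (regular_rmodule R)"
      using \<psi>D[OF True] \<phi>D[of i] by (intro rmodule_homI) (auto simp: R.a_ac R.rng_l_distr R.rng_m_closed)
    ultimately show ?thesis
      using \<psi>(1) insert.prems True by (intro exI[of _ ?\<psi>]) auto
  qed
qed auto

text \<open>
  \<open>x \<cdot> (m, r) = m x + x r\<close>: the unital action of the unitization on an \<open>R\<close>-module.
\<close>

definition unitization_act :: "('r, 'm, 'd) rmodule_scheme \<Rightarrow> 'm \<Rightarrow> int \<times> 'r \<Rightarrow> 'm" where
  "unitization_act M x u = x [^]\<^bsub>M\<^esub> fst u \<otimes>\<^bsub>M\<^esub> x \<star>\<^bsub>M\<^esub> snd u"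

context rmodule begin

lemma unitization_act_closed:
  "x \<in> carrier M \<Longrightarrow> snd u \<in> carrier R \<Longrightarrow> unitization_act M x u \<in> carrier M"
  by (simp add: unitization_act_def)

lemma unitization_act_add:
  assumes "rng R" "x \<in> carrier M" "snd u \<in> carrier R" "snd v \<in> carrier R"
  shows "unitization_act M x (u \<oplus>\<^bsub>unitization R\<^esub> v)
    = unitization_act M x u \<otimes> unitization_act M x v"
  using assms
  by (simp add: unitization_act_def rng.unitization_add int_pow_mult ract_add m_ac)

lemma unitization_act_ideal:
  assumes "rng R" "x \<in> carrier M" "snd u \<in> carrier R" "r \<in> carrier R"
  shows "unitization_act M x (u \<otimes>\<^bsub>unitization R\<^esub> (0, r)) = unitization_act M x u \<star> r"
proof -
  interpret R: rng R by fact
  have "(\<lambda>s. x \<star> s) \<in> hom (add_monoid R) M"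
    using assms by (auto intro!: homI simp: ract_add)
  then have "x \<star> ([fst u] \<cdot>\<^bsub>R\<^esub> r) = (x \<star> r) [^] fst u"
    unfolding add_pow_def using assms
    by (intro hom_int_pow) (auto intro: R.add.is_group is_group)
  moreover have "(x [^] fst u) \<star> r = (x \<star> r) [^] fst u"
    using assms by (intro hom_int_pow[OF ract_hom]) (auto intro: is_group)
  ultimately show ?thesis
    using assms by (simp add: unitization_act_def R.unitization_mult_ideal' R.rng_m_closed ract_add
        ract_mult ract_ract)
qed

end

text \<open>
  For a summand \<open>P\<close> of a free module \<open>F\<close>, the forms are the coordinates of the inclusion \<open>s\<close>, and the
  basis elements are the projections of the generators of \<open>F\<close>. Finite generation enters twice: since
  \<open>P\<close> is generated by finitely many sets \<open>xR\<close>, only finitely many coordinates are nonzero, and each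
  coordinate lies in the ideal \<open>R\<close> of the unitization. Conversely, a dual basis
  yields a section of the homomorphism from the free module on \<open>{x\<^sub>i}\<close> onto \<open>P\<close>.
\<close>

theorem fg_projective_iff_dual_basis:
  fixes R :: "('a, 'c) ring_scheme" and P :: "('a, 'b, 'd) rmodule_scheme"
  assumes R: "rng R"
  shows "fg_projective R P \<longleftrightarrow> rmodule R P \<and> has_dual_basis_in R P (carrier P)"
proof
  interpret R: rng R by fact
  assume "fg_projective R P"
  then obtain X0 and X :: "'b set" and Q :: "('a, 'b \<Rightarrow> int \<times> 'a) rmodule" where
    P: "rmodule R P" and X0: "finite X0" "X0 \<subseteq> carrier P"
    and gen: "carrier P = generate P {x \<star>\<^bsub>P\<^esub> r | x r. x \<in> X0 \<and> r \<in> carrier R}"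
    and Q: "rmodule R Q" and iso: "rmodule_iso R (direct_sum P Q) (free_rmodule R X)"
    unfolding fg_projective_def finitely_generated_def projective_def right_module_iff_rmodule
    by blast
  let ?F = "free_rmodule R X"
  interpret P: rmodule R P by fact
  interpret F: rmodule R ?F by (rule R.rmodule_free)
  obtain f g where f: "f \<in> rmodule_hom R (direct_sum P Q) ?F"
    and g: "g \<in> rmodule_hom R ?F (direct_sum P Q)"
    and gf: "\<And>w. w \<in> carrier (direct_sum P Q) \<Longrightarrow> g (f w) = w"
    using rmodule_isoE[OF iso rmodule_direct_sum[OF P Q]] by metis
  note homs = direct_sum_homs[OF P Q]
  define s where "s = (\<lambda>p. f (p, \<one>\<^bsub>Q\<^esub>))"
  define \<pi> where "\<pi> = (\<lambda>w. fst (g w))"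
  have s: "s \<in> rmodule_hom R P ?F" unfolding s_def by (rule rmodule_hom_compose[OF homs(3) f])
  have \<pi>: "\<pi> \<in> rmodule_hom R ?F P" unfolding \<pi>_def by (rule rmodule_hom_compose[OF g homs(1)])
  have \<pi>s: "\<pi> (s p) = p" if "p \<in> carrier P" for p
    using that gf[of "(p, \<one>\<^bsub>Q\<^esub>)"] Q unfolding \<pi>_def s_def
    by (auto simp: rmodule_def comm_group_def comm_monoid_def monoid.one_closed group.is_monoid)
  note sD = rmodule_homD[OF s] and \<pi>D = rmodule_homD[OF \<pi>]
  have sc: "snd (s p y) \<in> carrier R" if "p \<in> carrier P" for p y
    using sD(2)[OF that] by (simp add: free_rmodule_carrier)
  \<comment> \<open>The coordinates that occur in the generators; \<open>s(xr)\<close> has no others.\<close>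
  define Y where "Y = (\<Union>x\<in>X0. {y. s x y \<noteq> (0, \<zero>\<^bsub>R\<^esub>)})"
  have Y: "finite Y" "Y \<subseteq> X"
    using X0 sD(2) unfolding Y_def free_rmodule_carrier by blast+
  have gens: "fst (s (x \<star>\<^bsub>P\<^esub> r) y) = 0 \<and> (y \<notin> Y \<longrightarrow> s (x \<star>\<^bsub>P\<^esub> r) y = (0, \<zero>\<^bsub>R\<^esub>))"
    if "x \<in> X0" "r \<in> carrier R" for x r y
    using that X0 sc[of x y] by (auto simp: sD R.unitization_mult_ideal' Y_def)
  have supp: "fst (s p y) = 0 \<and> (y \<notin> Y \<longrightarrow> s p y = (0, \<zero>\<^bsub>R\<^esub>))" if "p \<in> carrier P" for p y
    using that[unfolded gen]
  proof (induction p rule: generate.induct)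
    case one
    then show ?case using rmodule_hom_one[OF s P F.rmodule_axioms] by simp
  next
    case (incl h)
    then show ?case using gens by auto
  next
    case (inv h)
    then obtain x r where h: "h = x \<star>\<^bsub>P\<^esub> r" "x \<in> X0" "r \<in> carrier R" by blast
    then have "inv\<^bsub>P\<^esub> h = x \<star>\<^bsub>P\<^esub> (\<ominus>\<^bsub>R\<^esub> r)"
      using X0 P.ract_add[of x "\<ominus>\<^bsub>R\<^esub> r" r] P.ract_zero[OF R, of x]
      by (intro P.inv_equality) (auto simp: R.l_neg)
    then show ?case using gens[of x "\<ominus>\<^bsub>R\<^esub> r"] h by simp
  next
    case (eng h1 h2)
    then have "h1 \<in> carrier P" "h2 \<in> carrier P" using gen by auto
    then show ?case using eng by (auto simp: sD R.unitization_add)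
  qed
  define \<phi> where "\<phi> = (\<lambda>y p. snd (s p y))"
  have "\<phi> y \<in> rmodule_hom R P (regular_rmodule R)" for y
    using supp sc
    by (intro rmodule_homI) (auto simp: \<phi>_def sD R.unitization_add R.unitization_mult_ideal' R.rng_m_closed)
  moreover have "finprod P (\<lambda>y. \<pi> (R.free_gen y) \<star>\<^bsub>P\<^esub> \<phi> y p) Y = p" if p: "p \<in> carrier P" for p
  proof -
    have "s p = finprod ?F (\<lambda>y. R.free_gen y \<star>\<^bsub>?F\<^esub> \<phi> y p) Y"
      using Y sc[OF p] supp[OF p]
      by (subst R.free_gen_combination) (auto simp: \<phi>_def fun_eq_iff prod_eq_iff)
    then have "p = \<pi> (finprod ?F (\<lambda>y. R.free_gen y \<star>\<^bsub>?F\<^esub> \<phi> y p) Y)"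
      using \<pi>s[OF p] by simp
    also have "\<dots> = finprod P (\<lambda>y. \<pi> (R.free_gen y \<star>\<^bsub>?F\<^esub> \<phi> y p)) Y"
      using Y sc[OF p]
      by (intro rmodule_hom_finprod[OF \<pi> F.rmodule_axioms P] Pi_I F.ract_closed R.free_gen_closed)
        (auto simp: \<phi>_def)
    also have "\<dots> = finprod P (\<lambda>y. \<pi> (R.free_gen y) \<star>\<^bsub>P\<^esub> \<phi> y p) Y"
      using sc[OF p]
      by (intro P.finprod_cong' refl Pi_I P.ract_closed \<pi>D R.free_gen_closed subsetD[OF Y(2)])
        (auto simp: \<phi>_def)
    finally show ?thesis by simp
  qed
  ultimately have "dual_basis R P Y (\<lambda>y. \<pi> (R.free_gen y)) \<phi>"
    using Y \<pi>D(2)[OF R.free_gen_closed] by (auto simp: dual_basis_def)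
  then show "rmodule R P \<and> has_dual_basis_in R P (carrier P)"
    using P by (auto intro!: has_dual_basis_inI dest: dual_basisD(2))
next
  interpret R: rng R by fact
  assume *: "rmodule R P \<and> has_dual_basis_in R P (carrier P)"
  then interpret P: rmodule R P by simp
  from * obtain n :: nat and x \<phi>0 where db: "dual_basis R P {..<n} x \<phi>0"
    by (auto simp: has_dual_basis_in_def)
  have "x \<in> {..<n} \<rightarrow> carrier P"
    "\<And>i. i \<in> {..<n} \<Longrightarrow> \<phi>0 i \<in> rmodule_hom R P (regular_rmodule R)"
    using dual_basisD(2,3)[OF db] by auto
  from P.dual_basis_distinct[where \<phi> = \<phi>0, OF R dual_basisD(1)[OF db] this]
  obtain \<phi> where \<phi>: "\<And>y. y \<in> x ` {..<n} \<Longrightarrow> \<phi> y \<in> rmodule_hom R P (regular_rmodule R)"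
    and "\<And>m. m \<in> carrier P \<Longrightarrow> finprod P (\<lambda>y. y \<star>\<^bsub>P\<^esub> \<phi> y m) (x ` {..<n})
           = finprod P (\<lambda>i. x i \<star>\<^bsub>P\<^esub> \<phi>0 i m) {..<n}"
    by blast
  then have eq: "\<And>m. m \<in> carrier P \<Longrightarrow> finprod P (\<lambda>y. y \<star>\<^bsub>P\<^esub> \<phi> y m) (x ` {..<n}) = m"
    using dual_basisD(4)[OF db] by simp
  define X where "X = x ` {..<n}"
  have X: "finite X" "X \<subseteq> carrier P"
    using dual_basisD[OF db] by (auto simp: X_def)
  note \<phi>D = rmodule_homD[OF \<phi>, folded X_def, simplified] and eq = eq[folded X_def]
  let ?F = "free_rmodule R X"
  interpret F: rmodule R ?F by (rule R.rmodule_free)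
  have "finitely_generated R P"
  proof -
    let ?G = "generate P {x \<star>\<^bsub>P\<^esub> r | x r. x \<in> X \<and> r \<in> carrier R}"
    have sub: "{x \<star>\<^bsub>P\<^esub> r | x r. x \<in> X \<and> r \<in> carrier R} \<subseteq> carrier P" using X by auto
    interpret G: subgroup ?G P by (rule P.generate_is_subgroup[OF sub])
    have "finprod P h Z \<in> ?G" if "finite Z" "h \<in> Z \<rightarrow> ?G" for h and Z :: "'b set"
      using that
      by (induction Z rule: finite_induct) (auto simp: Pi_iff)
    moreover have "y \<star>\<^bsub>P\<^esub> \<phi> y m \<in> ?G" if "y \<in> X" "m \<in> carrier P" for y m
      using that \<phi>D(2)[of y m] by (blast intro: generate.incl)
    ultimately have "m \<in> ?G" if "m \<in> carrier P" for m
      using eq[OF that] X(1) that by (metis (no_types, lifting) Pi_I)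
    then have "carrier P = ?G" using G.subset by blast
    then show ?thesis
      using X P.rmodule_axioms by (auto simp: finitely_generated_def right_module_iff_rmodule)
  qed
  moreover have "projective R P"
  proof -
    define s where "s = (\<lambda>p y. if y \<in> X then (0 :: int, \<phi> y p) else (0, \<zero>\<^bsub>R\<^esub>))"
    define \<pi> where "\<pi> = (\<lambda>w. finprod P (\<lambda>y. unitization_act P y (w y)) X)"
    have s: "s \<in> rmodule_hom R P ?F"
    proof (rule rmodule_homI)
      show "s p \<in> carrier ?F" if "p \<in> carrier P" for p
        using that X(1) \<phi>D(2)
        by (auto simp: free_rmodule_carrier s_def intro: finite_subset[of _ X])
    qed (use \<phi>D in \<open>auto simp: s_def fun_eq_iff R.unitization_add R.unitization_mult_ideal R.rng_m_closed\<close>)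
    have act: "(\<lambda>y. unitization_act P y (w y)) \<in> X \<rightarrow> carrier P" if "w \<in> carrier ?F" for w
      using that X by (auto simp: free_rmodule_carrier intro!: P.unitization_act_closed)
    have \<pi>: "\<pi> \<in> rmodule_hom R ?F P"
    proof (rule rmodule_homI)
      fix v w assume vw: "v \<in> carrier ?F" "w \<in> carrier ?F"
      then have "\<pi> (v \<otimes>\<^bsub>?F\<^esub> w)
          = finprod P (\<lambda>y. unitization_act P y (v y) \<otimes>\<^bsub>P\<^esub> unitization_act P y (w y)) X"
        unfolding \<pi>_def using X act
        by (intro P.finprod_cong')
          (auto simp: P.unitization_act_add[OF R] free_rmodule_carrier Pi_iff subset_iff)
      then show "\<pi> (v \<otimes>\<^bsub>?F\<^esub> w) = \<pi> v \<otimes>\<^bsub>P\<^esub> \<pi> w"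
        using vw act by (simp add: P.finprod_multf \<pi>_def)
    next
      fix w r assume w: "w \<in> carrier ?F" and r: "r \<in> carrier R"
      have "\<pi> (w \<star>\<^bsub>?F\<^esub> r) = finprod P (\<lambda>y. unitization_act P y (w y) \<star>\<^bsub>P\<^esub> r) X"
        unfolding \<pi>_def using X act[OF w] w r
        by (intro P.finprod_cong')
          (auto simp: P.unitization_act_ideal[OF R] free_rmodule_carrier Pi_iff subset_iff)
      also have "\<dots> = \<pi> w \<star>\<^bsub>P\<^esub> r"
        unfolding \<pi>_def using P.ract_hom[OF r] act[OF w] r
        by (intro P.hom_finprod[symmetric]) (auto intro: P.comm_monoid_axioms)
      finally show "\<pi> (w \<star>\<^bsub>?F\<^esub> r) = \<pi> w \<star>\<^bsub>P\<^esub> r" .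
    qed (use act in \<open>auto simp: \<pi>_def\<close>)
    have "\<pi> (s p) = p" if p: "p \<in> carrier P" for p
    proof -
      have "\<pi> (s p) = finprod P (\<lambda>y. y \<star>\<^bsub>P\<^esub> \<phi> y p) X"
        unfolding \<pi>_def using X \<phi>D(2) p
        by (intro P.finprod_cong') (auto simp: s_def unitization_act_def subset_iff)
      then show ?thesis using eq[OF p] by simp
    qed
    from split_epi_direct_sum[where p = \<pi> and s = s, OF F.rmodule_axioms P.rmodule_axioms \<pi> s this]
    show ?thesis
      using P.rmodule_axioms unfolding projective_def right_module_iff_rmodule by blast
  qed
  ultimately show "fg_projective R P" by (simp add: fg_projective_def)
qed

section \<open>Isomorphism classes\<close>

lemma fg_projective_rmodule: "fg_projective R P \<Longrightarrow> rmodule R P"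
  by (simp add: fg_projective_def projective_def right_module_iff_rmodule)

lemma fg_projective_iso:
  assumes "rng R" "fg_projective R P" "rmodule R Q" "rmodule_iso R P Q"
  shows "fg_projective R Q"
  using assms has_dual_basis_in_iso[OF assms(4)] by (simp add: fg_projective_iff_dual_basis)

lemma fg_projective_direct_sum:
  assumes R: "rng R" and P: "fg_projective R P" and Q: "fg_projective R Q"
  shows "fg_projective R (direct_sum P Q)"
proof -
  from P Q interpret P: rmodule R P + Q: rmodule R Q
    by (simp_all add: fg_projective_rmodule)
  show ?thesis
    using P Q has_dual_basis_in_direct_sum[OF P.rmodule_axioms Q.rmodule_axioms]
      rmodule_direct_sum[OF P.rmodule_axioms Q.rmodule_axioms]
    by (simp add: fg_projective_iff_dual_basis[OF R])
qed

text \<open>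
  The complement of a summand of a finitely generated projective module is itself a retract of
  that module.
\<close>

lemma fg_projective_complement:
  assumes R: "rng R" and L: "fg_projective R L" and M: "rmodule R M" and K: "rmodule R K"
    and iso: "rmodule_iso R (direct_sum M K) L"
  shows "fg_projective R K"
proof -
  note MK = rmodule_direct_sum[OF M K]
  have "fg_projective R (direct_sum M K)"
    using fg_projective_iso[OF R L MK rmodule_iso_sym[OF iso MK]] .
  then have "has_dual_basis_in R (direct_sum M K) (carrier (direct_sum M K))"
    by (simp add: fg_projective_iff_dual_basis[OF R])
  then have "has_dual_basis_in R K (carrier K)"
    by (rule has_dual_basis_in_retract[OF MK K direct_sum_homs(2,4)[OF M K], rotated]) auto
  then show ?thesis using K by (simp add: fg_projective_iff_dual_basis[OF R])
qed

text \<open>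
  Transport of structure along a map that is injective on the carrier. It serves to move
  modules to the type on which isomorphism classes are formed.
\<close>

definition image_rmodule :: "('m \<Rightarrow> 'n) \<Rightarrow> ('r, 'm, 'd) rmodule_scheme \<Rightarrow> ('r, 'n) rmodule" where
  "image_rmodule h M = (let g = inv_into (carrier M) h in
    \<lparr>carrier = h ` carrier M, monoid.mult = (\<lambda>a b. h (g a \<otimes>\<^bsub>M\<^esub> g b)), one = h \<one>\<^bsub>M\<^esub>,
     ract = (\<lambda>a r. h (g a \<star>\<^bsub>M\<^esub> r))\<rparr>)"

lemma image_rmodule:
  assumes M: "rmodule R M" and h: "inj_on h (carrier M)"
  shows "rmodule R (image_rmodule h M)" and "rmodule_iso R (image_rmodule h M) M"
proof -
  interpret M: rmodule R M by fact
  let ?N = "image_rmodule h M"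
  have simps: "carrier ?N = h ` carrier M" "\<one>\<^bsub>?N\<^esub> = h \<one>\<^bsub>M\<^esub>"
    "\<And>x y. \<lbrakk>x \<in> carrier M; y \<in> carrier M\<rbrakk> \<Longrightarrow> h x \<otimes>\<^bsub>?N\<^esub> h y = h (x \<otimes>\<^bsub>M\<^esub> y)"
    "\<And>x r. x \<in> carrier M \<Longrightarrow> h x \<star>\<^bsub>?N\<^esub> r = h (x \<star>\<^bsub>M\<^esub> r)"
    using h by (simp_all add: image_rmodule_def Let_def)
  have "comm_group ?N"
    by (rule comm_groupI) (auto simp: simps M.m_ac intro!: bexI[where x = "inv\<^bsub>M\<^esub> _"])
  then show N: "rmodule R ?N"
    by (intro rmodule.intro rmodule_axioms.intro)
      (auto simp: simps M.ract_mult M.ract_add M.ract_ract)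
  have "rmodule_iso R M ?N"
    unfolding rmodule_iso_def using h
    by (intro bexI[of _ h] rmodule_homI) (auto simp: simps bij_betw_def)
  then show "rmodule_iso R ?N M" by (rule rmodule_iso_sym[OF _ M])
qed

text \<open>
  The coordinates \<open>p \<mapsto> (\<phi>\<^sub>i(p))\<^sub>i\<close> with respect to a dual basis embed \<open>P\<close> into \<open>R\<^sup>n\<close>, hence
  into the functions from \<open>nat\<close> to \<open>R\<close>.
\<close>

lemma iso_class_nonempty:
  fixes R :: "('a, 'c) ring_scheme"
  assumes R: "rng R" and P: "fg_projective R P"
  obtains N :: "('a, nat \<Rightarrow> 'a) rmodule" where "N \<in> iso_class R P"
proof -
  interpret P: rmodule R P using P by (rule fg_projective_rmodule)
  obtain n :: nat and x \<phi> where db: "dual_basis R P {..<n} x \<phi>"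
    using P by (auto simp: fg_projective_iff_dual_basis[OF R] has_dual_basis_in_def)
  define h where "h = (\<lambda>p i. if i < n then \<phi> i p else \<zero>\<^bsub>R\<^esub>)"
  have "inj_on h (carrier P)"
  proof (rule inj_onI)
    fix p q assume pq: "p \<in> carrier P" "q \<in> carrier P" and eq: "h p = h q"
    have "\<phi> i p = \<phi> i q" if "i \<in> {..<n}" for i
      using fun_cong[OF eq, of i] that by (simp add: h_def)
    then have "finprod P (\<lambda>i. x i \<star>\<^bsub>P\<^esub> \<phi> i p) {..<n} = finprod P (\<lambda>i. x i \<star>\<^bsub>P\<^esub> \<phi> i q) {..<n}"
      using dual_basisD(2)[OF db] rmodule_homD(2)[OF dual_basisD(3)[OF db], simplified] pq
      by (intro P.finprod_cong') auto
    then show "p = q" using dual_basisD(4)[OF db] pq by simp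
  qed
  note N = image_rmodule[OF P.rmodule_axioms this]
  have "fg_projective R (image_rmodule h P)"
    using fg_projective_iso[OF R P N(1) rmodule_iso_sym[OF N(2,1)]] .
  then show thesis using N(2) by (intro that[of "image_rmodule h P"]) (simp add: iso_class_def)
qed

lemma iso_classD:
  assumes "M \<in> iso_class R P" shows "fg_projective R M" "rmodule R M" "rmodule_iso R M P"
  using assms by (simp_all add: iso_class_def fg_projective_rmodule)

lemma iso_class_eqI:
  assumes "rmodule R M" "rmodule_iso R M N" shows "iso_class R M = iso_class R N"
  using assms rmodule_iso_trans[of R _ M N] rmodule_iso_trans[of R _ N M] rmodule_iso_sym[of R M N]
  by (auto simp: iso_class_def)

lemma iso_class_eqD:
  assumes R: "rng R" and M: "fg_projective R M" and eq: "iso_class R M = iso_class R N"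
  shows "rmodule_iso R M N"
proof -
  obtain L where "L \<in> iso_class R M" using iso_class_nonempty[OF R M] .
  then show ?thesis
    using eq by (metis iso_classD(2,3) rmodule_iso_sym rmodule_iso_trans)
qed

lemma iso_class_in_V_monoid:
  assumes R: "rng R" and P: "fg_projective R P"
  shows "iso_class R P \<in> carrier (V_monoid R)"
proof -
  obtain N where N: "N \<in> iso_class R P" using iso_class_nonempty[OF R P] .
  then have "iso_class R P = iso_class R N"
    using iso_classD[OF N] by (metis iso_class_eqI)
  then show ?thesis using iso_classD(1)[OF N] by (auto simp: V_monoid_def)
qed

lemma V_monoid_carrierE:
  fixes R :: "('a, 'c) ring_scheme"
  assumes "x \<in> carrier (V_monoid R)"
  obtains P :: "('a, nat \<Rightarrow> 'a) rmodule" where "fg_projective R P" "x = iso_class R P"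
  using assms by (auto simp: V_monoid_def)

lemma V_monoid_mult:
  assumes R: "rng R" and P: "fg_projective R P" and Q: "fg_projective R Q"
  shows "iso_class R P \<otimes>\<^bsub>V_monoid R\<^esub> iso_class R Q = iso_class R (direct_sum P Q)"
proof -
  have "iso_class R (direct_sum P' Q') = iso_class R (direct_sum P Q)"
    if "P' \<in> iso_class R P" "Q' \<in> iso_class R Q" for P' Q'
    using that by (intro iso_class_eqI rmodule_direct_sum direct_sum_iso_cong) (auto dest: iso_classD)
  moreover obtain P' where "P' \<in> iso_class R P" using iso_class_nonempty[OF R P] .
  moreover obtain Q' where "Q' \<in> iso_class R Q" using iso_class_nonempty[OF R Q] .
  ultimately show ?thesis by (auto simp: V_monoid_def)
qed

section \<open>Modules generated by their corner\<close>

locale idempotent_rng = rng R for R (structure) +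
  fixes \<alpha>
  assumes idem_closed [simp]: "\<alpha> \<in> carrier R"
    and idem [simp]: "\<alpha> \<otimes> \<alpha> = \<alpha>"
begin

abbreviation "S \<equiv> corner_ring R \<alpha>"
abbreviation "B \<equiv> corner_bimodule R \<alpha>"

lemma corner_ring_simps [simp]:
  "monoid.mult S = monoid.mult R" "ring.add S = ring.add R" "\<zero>\<^bsub>S\<^esub> = \<zero>"
  by (simp_all add: corner_ring_def)

lemma corner_bimodule_simps [simp]:
  "monoid.mult B = ring.add R" "\<one>\<^bsub>B\<^esub> = \<zero>" "ract B = monoid.mult R" "lact B = monoid.mult R"
  by (simp_all add: corner_bimodule_def)

lemma corner_ring_carrier:
  "x \<in> carrier S \<longleftrightarrow> x \<in> carrier R \<and> \<alpha> \<otimes> x = x \<and> x \<otimes> \<alpha> = x"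
proof
  assume "x \<in> carrier S"
  then obtain y where y: "y \<in> carrier R" "x = \<alpha> \<otimes> y \<otimes> \<alpha>" by (auto simp: corner_ring_def)
  then have "\<alpha> \<otimes> (\<alpha> \<otimes> (y \<otimes> \<alpha>)) = \<alpha> \<otimes> (y \<otimes> \<alpha>)"
    by (simp add: rng_m_assoc[symmetric] rng_m_closed)
  with y show "x \<in> carrier R \<and> \<alpha> \<otimes> x = x \<and> x \<otimes> \<alpha> = x"
    by (auto simp: rng_m_closed rng_m_assoc)
next
  assume "x \<in> carrier R \<and> \<alpha> \<otimes> x = x \<and> x \<otimes> \<alpha> = x"
  then show "x \<in> carrier S" by (auto simp: corner_ring_def intro!: exI[of _ x])
qed

lemma corner_bimodule_carrier: "x \<in> carrier B \<longleftrightarrow> x \<in> carrier R \<and> \<alpha> \<otimes> x = x"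
proof -
  have "\<alpha> \<otimes> (\<alpha> \<otimes> y) = \<alpha> \<otimes> y" if "y \<in> carrier R" for y
    using that by (simp add: rng_m_assoc[symmetric])
  then show ?thesis by (auto simp: corner_bimodule_def rng_m_closed) metis
qed

lemma corner_ring_subset: "carrier S \<subseteq> carrier R"
  by (auto simp: corner_ring_carrier)

lemma m_inv_idem:
  assumes "x \<in> carrier R"
  shows "\<alpha> \<otimes> (\<ominus> x) = \<ominus> (\<alpha> \<otimes> x)" "(\<ominus> x) \<otimes> \<alpha> = \<ominus> (x \<otimes> \<alpha>)"
proof -
  have "(\<alpha> \<otimes> (\<ominus> x)) \<oplus> (\<alpha> \<otimes> x) = \<zero>" "((\<ominus> x) \<otimes> \<alpha>) \<oplus> (x \<otimes> \<alpha>) = \<zero>"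
    using assms by (simp_all add: rng_r_distr[symmetric] rng_l_distr[symmetric] l_neg)
  then show "\<alpha> \<otimes> (\<ominus> x) = \<ominus> (\<alpha> \<otimes> x)" "(\<ominus> x) \<otimes> \<alpha> = \<ominus> (x \<otimes> \<alpha>)"
    using assms by (simp_all add: minus_equality rng_m_closed)
qed

lemma rng_corner: "rng S"
proof -
  have "abelian_group S"
    by (rule abelian_groupI)
      (auto simp: corner_ring_carrier rng_l_distr rng_r_distr a_ac m_inv_idem r_neg
        intro!: bexI[where x = "\<ominus> _"])
  then show ?thesis
    by (intro rng.intro rng_axioms.intro)
      (auto simp: corner_ring_carrier rng_m_closed rng_l_distr rng_r_distr rng_m_assoc,
       simp add: rng_m_assoc[symmetric])
qed

lemma rmodule_corner_bimodule: "rmodule R B"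
proof -
  have "comm_group B"
    by (rule comm_groupI)
      (auto simp: corner_bimodule_carrier rng_r_distr a_ac m_inv_idem r_neg
        intro!: bexI[where x = "\<ominus> _"])
  then show ?thesis
    by (intro rmodule.intro rmodule_axioms.intro)
      (auto simp: corner_bimodule_carrier rng_m_closed rng_l_distr rng_r_distr rng_m_assoc,
       simp add: rng_m_assoc[symmetric])
qed

definition corner_set :: "('a, 'm, 'd) rmodule_scheme \<Rightarrow> 'm set" where
  "corner_set M = {x \<in> carrier M. x \<star>\<^bsub>M\<^esub> \<alpha> = x}"

definition corner_rmodule :: "('a, 'm, 'd) rmodule_scheme \<Rightarrow> ('a, 'm) rmodule" where
  "corner_rmodule M = rmodule_on M (corner_set M)"

text \<open>
  These are the finitely generated projective \<open>R\<close>-modules \<open>M\<close> with \<open>M = M\<alpha>R\<close>.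
\<close>

definition corner_generated :: "('a, 'm, 'd) rmodule_scheme \<Rightarrow> bool" where
  "corner_generated M \<longleftrightarrow> rmodule R M \<and> has_dual_basis_in R M (corner_set M)"

lemma corner_rmodule_simps [simp]:
  "carrier (corner_rmodule M) = corner_set M" "monoid.mult (corner_rmodule M) = monoid.mult M"
  "one (corner_rmodule M) = one M" "ract (corner_rmodule M) = ract M"
  by (simp_all add: corner_rmodule_def)

lemma rmodule_corner:
  assumes "rmodule R M" shows "rmodule S (corner_rmodule M)"
proof -
  interpret M: rmodule R M by fact
  have "comm_group (corner_rmodule M)"
    by (rule comm_groupI)
      (auto simp: corner_set_def M.ract_mult M.ract_inv M.m_ac intro: bexI[where x = "inv\<^bsub>M\<^esub> _"])
  then show ?thesis
    by (intro rmodule.intro rmodule_axioms.intro)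
      (auto simp: corner_set_def corner_ring_carrier M.ract_mult M.ract_add M.ract_ract[symmetric])
qed

lemma corner_generated_fg_projective:
  assumes "corner_generated M" shows "fg_projective R M"
  using assms unfolding corner_generated_def has_dual_basis_in_def
  by (auto simp: fg_projective_iff_dual_basis[OF rng_axioms] has_dual_basis_in_def dest: dual_basisD(2))

lemma corner_hom:
  assumes "f \<in> rmodule_hom R M N"
  shows "f \<in> rmodule_hom S (corner_rmodule M) (corner_rmodule N)"
proof (rule rmodule_homI)
  show "f x \<in> carrier (corner_rmodule N)" if "x \<in> carrier (corner_rmodule M)" for x
    using that rmodule_homD(2)[OF assms, of x] rmodule_homD(4)[OF assms, of x \<alpha>]
    by (simp add: corner_set_def)
qed (auto simp: rmodule_homD[OF assms] corner_set_def corner_ring_carrier)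

lemma corner_iso:
  assumes "rmodule_iso R M N" "rmodule R M"
  shows "rmodule_iso S (corner_rmodule M) (corner_rmodule N)"
proof -
  obtain f g where fg: "f \<in> rmodule_hom R M N" "g \<in> rmodule_hom R N M"
    "\<And>x. x \<in> carrier M \<Longrightarrow> g (f x) = x" "\<And>y. y \<in> carrier N \<Longrightarrow> f (g y) = y"
    using rmodule_isoE[OF assms] by blast
  show ?thesis
    using fg(3,4) rmodule_homD(2)[OF corner_hom[OF fg(2)]]
    by (intro rmodule_isoI[OF corner_hom[OF fg(1)], of g]) (auto simp: corner_set_def)
qed

lemma corner_direct_sum_iso:
  "rmodule_iso S (corner_rmodule (direct_sum M N)) (direct_sum (corner_rmodule M) (corner_rmodule N))"
  by (rule rmodule_isoI[where f = id and g = id])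
    (auto intro!: rmodule_homI simp: corner_set_def)

lemma corner_generated_retract:
  assumes L: "corner_generated L" and M: "rmodule R M"
    and p: "p \<in> rmodule_hom R L M" and s: "s \<in> rmodule_hom R M L"
    and ps: "\<And>x. x \<in> carrier M \<Longrightarrow> p (s x) = x"
  shows "corner_generated M"
proof -
  have "p ` (corner_set L \<inter> carrier L) \<subseteq> corner_set M"
    using rmodule_homD(2)[OF corner_hom[OF p]] by auto
  then show ?thesis
    using L M has_dual_basis_in_retract[OF _ M p s ps, where C = "corner_set L" and D = "corner_set M"]
    unfolding corner_generated_def by blast
qed

lemma corner_generated_summand:
  assumes L: "corner_generated L" and M: "rmodule R M" and K: "rmodule R K"
    and iso: "rmodule_iso R (direct_sum M K) L"
  shows "corner_generated M"
proof -
  note MK = rmodule_direct_sum[OF M K]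
  interpret K: rmodule R K by fact
  obtain f g where fg: "f \<in> rmodule_hom R (direct_sum M K) L" "g \<in> rmodule_hom R L (direct_sum M K)"
    "\<And>x. x \<in> carrier (direct_sum M K) \<Longrightarrow> g (f x) = x"
    using rmodule_isoE[OF iso MK] by metis
  show ?thesis
    using fg(3)
    by (intro corner_generated_retract[OF L M, of "\<lambda>w. fst (g w)" "\<lambda>x. f (x, \<one>\<^bsub>K\<^esub>)"]
        rmodule_hom_compose[OF fg(2) direct_sum_homs(1)[OF M K]]
        rmodule_hom_compose[OF direct_sum_homs(3)[OF M K] fg(1)]) auto
qed

lemma corner_generated_iso:
  assumes "corner_generated L" "rmodule_iso R L M" "rmodule R M"
  shows "corner_generated M"
proof -
  have L: "rmodule R L" using assms(1) by (simp add: corner_generated_def)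
  obtain f g where "f \<in> rmodule_hom R L M" "g \<in> rmodule_hom R M L"
    "\<And>y. y \<in> carrier M \<Longrightarrow> f (g y) = y"
    using rmodule_isoE[OF assms(2) L] by metis
  then show ?thesis by (rule corner_generated_retract[OF assms(1,3)])
qed

lemma corner_generated_direct_sum:
  assumes M: "corner_generated M" and N: "corner_generated N"
  shows "corner_generated (direct_sum M N)"
proof -
  from M N interpret M: rmodule R M + N: rmodule R N by (simp_all add: corner_generated_def)
  have "corner_set (direct_sum M N) = corner_set M \<times> corner_set N"
    by (auto simp: corner_set_def)
  moreover have "\<one>\<^bsub>M\<^esub> \<in> corner_set M" "\<one>\<^bsub>N\<^esub> \<in> corner_set N" by (simp_all add: corner_set_def)
  ultimately show ?thesis
    using M N rmodule_direct_sum[OF M.rmodule_axioms N.rmodule_axioms]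
      has_dual_basis_in_direct_sum[OF M.rmodule_axioms N.rmodule_axioms]
    by (auto simp: corner_generated_def)
qed

lemma corner_bimodule_hom_regular:
  assumes "f \<in> rmodule_hom R M B" shows "f \<in> rmodule_hom R M (regular_rmodule R)"
  using rmodule_homD[OF assms] by (intro rmodule_homI) (auto simp: corner_bimodule_carrier)

text \<open>
  The single element \<open>\<alpha>\<close> with the inclusion \<open>\<alpha>R \<rightarrow> R\<close> as its form is a dual basis of \<open>\<alpha>R\<close>.
\<close>

lemma corner_generated_bimodule: "corner_generated B"
proof -
  interpret B: rmodule R B by (rule rmodule_corner_bimodule)
  have "dual_basis R B {()} (\<lambda>_. \<alpha>) (\<lambda>_ b. b)"
    unfolding dual_basis_def
    by (auto intro!: rmodule_homI simp: corner_bimodule_carrier rng_m_closed)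
  then show ?thesis
    unfolding corner_generated_def
    by (auto intro!: has_dual_basis_inI B.rmodule_axioms
        simp: corner_set_def corner_bimodule_carrier)
qed

text \<open>
  Multiplying the coordinate forms by \<open>\<alpha>\<close> makes one dual basis serve both for \<open>M\<close> over \<open>R\<close> and
  for \<open>M\<alpha>\<close> over \<open>\<alpha>R\<alpha>\<close>.
\<close>

lemma corner_generated_dual_basis:
  assumes M: "corner_generated M"
  obtains n :: nat and x \<phi> where "dual_basis R M {..<n} x \<phi>"
    "dual_basis S (corner_rmodule M) {..<n} x \<phi>"
proof -
  from M interpret M: rmodule R M by (simp add: corner_generated_def)
  interpret C: rmodule S "corner_rmodule M" by (rule rmodule_corner) (rule M.rmodule_axioms)
  obtain n :: nat and x \<phi> where db: "dual_basis R M {..<n} x \<phi>" and x: "x ` {..<n} \<subseteq> corner_set M"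
    using M by (auto simp: corner_generated_def has_dual_basis_in_def)
  note D = dual_basisD[OF db]
  note \<phi>D = rmodule_homD[OF D(3), simplified]
  define \<psi> where "\<psi> = (\<lambda>i m. \<alpha> \<otimes> \<phi> i m)"
  have \<psi>R: "\<psi> i \<in> rmodule_hom R M (regular_rmodule R)" if "i < n" for i
    using that \<phi>D by (intro rmodule_homI) (auto simp: \<psi>_def rng_r_distr rng_m_assoc rng_m_closed)
  have \<psi>S: "\<psi> i m \<in> carrier S" if "i < n" "m \<in> corner_set M" for i m
  proof -
    have "\<phi> i m \<in> carrier R" "\<phi> i m \<otimes> \<alpha> = \<phi> i m"
      using that \<phi>D(2)[of i m] \<phi>D(4)[of i m \<alpha>] by (auto simp: corner_set_def)
    then show ?thesis
      by (auto simp: \<psi>_def corner_ring_carrier rng_m_closed rng_m_assoc, simp add: rng_m_assoc[symmetric])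
  qed
  have sum: "finprod M (\<lambda>i. x i \<star>\<^bsub>M\<^esub> \<psi> i m) {..<n} = m" if m: "m \<in> carrier M" for m
  proof -
    have xi: "x i \<in> carrier M" "x i \<star>\<^bsub>M\<^esub> \<alpha> = x i" if "i < n" for i
      using x that by (auto simp: corner_set_def)
    have "finprod M (\<lambda>i. x i \<star>\<^bsub>M\<^esub> \<psi> i m) {..<n} = finprod M (\<lambda>i. x i \<star>\<^bsub>M\<^esub> \<phi> i m) {..<n}"
      using xi \<phi>D(2) m by (intro M.finprod_cong') (auto simp: \<psi>_def M.ract_ract)
    then show ?thesis using D(4) m by simp
  qed
  have "\<psi> i \<in> rmodule_hom S (corner_rmodule M) (regular_rmodule S)" if "i < n" for i
    using that \<psi>S \<phi>D
    by (intro rmodule_homI)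
      (auto simp: \<psi>_def corner_set_def corner_ring_carrier rng_r_distr rng_m_assoc)
  moreover have "finprod (corner_rmodule M) (\<lambda>i. x i \<star>\<^bsub>M\<^esub> \<psi> i m) {..<n} = m"
    if m: "m \<in> corner_set M" for m
  proof -
    have "(\<lambda>y. y) \<in> hom (corner_rmodule M) M"
      by (rule homI) (auto simp: corner_set_def)
    moreover have "x i \<star>\<^bsub>M\<^esub> \<psi> i m \<in> corner_set M" if "i < n" for i
      using C.ract_closed[of "x i" "\<psi> i m"] x \<psi>S[OF that m] that by auto
    ultimately have "finprod (corner_rmodule M) (\<lambda>i. x i \<star>\<^bsub>M\<^esub> \<psi> i m) {..<n}
        = finprod M (\<lambda>i. x i \<star>\<^bsub>M\<^esub> \<psi> i m) {..<n}"
      by (intro M.hom_finprod[where h = "\<lambda>y. y"]) (auto intro: C.comm_monoid_axioms)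
    then show ?thesis using sum m by (simp add: corner_set_def)
  qed
  ultimately have "dual_basis S (corner_rmodule M) {..<n} x \<psi>"
    using x by (auto simp: dual_basis_def)
  moreover have "dual_basis R M {..<n} x \<psi>"
    using D(2) \<psi>R sum by (auto simp: dual_basis_def)
  ultimately show thesis using that by blast
qed

lemma fg_projective_corner:
  assumes M: "corner_generated M" shows "fg_projective S (corner_rmodule M)"
proof -
  from M have "rmodule S (corner_rmodule M)"
    by (simp add: corner_generated_def rmodule_corner)
  moreover obtain n :: nat and x \<phi> where db: "dual_basis S (corner_rmodule M) {..<n} x \<phi>"
    using corner_generated_dual_basis[OF M] by metis
  ultimately show ?thesis
    unfolding fg_projective_iff_dual_basis[OF rng_corner]
    using has_dual_basis_inI[OF _ db] dual_basisD(2)[OF db] by blast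
qed

lemma corner_hom_unique:
  assumes M: "corner_generated M" and N: "rmodule R N"
    and f: "f \<in> rmodule_hom R M N" and g: "g \<in> rmodule_hom R M N"
    and eq: "\<And>y. y \<in> corner_set M \<Longrightarrow> f y = g y" and m: "m \<in> carrier M"
  shows "f m = g m"
proof -
  from M interpret M: rmodule R M by (simp add: corner_generated_def)
  interpret N: rmodule R N by fact
  obtain n :: nat and x \<phi> where db: "dual_basis R M {..<n} x \<phi>" and x: "x ` {..<n} \<subseteq> corner_set M"
    using M by (auto simp: corner_generated_def has_dual_basis_in_def)
  note D = dual_basisD[OF db] and \<phi>D = rmodule_homD[OF dual_basisD(3)[OF db], simplified]
  have *: "h m = finprod N (\<lambda>i. h (x i) \<star>\<^bsub>N\<^esub> \<phi> i m) {..<n}" if h: "h \<in> rmodule_hom R M N" for h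
  proof -
    have "h m = h (finprod M (\<lambda>i. x i \<star>\<^bsub>M\<^esub> \<phi> i m) {..<n})" using D(4)[OF m] by simp
    also have "\<dots> = finprod N (\<lambda>i. h (x i \<star>\<^bsub>M\<^esub> \<phi> i m)) {..<n}"
      using D \<phi>D m by (intro rmodule_hom_finprod[OF h M.rmodule_axioms N]) auto
    also have "\<dots> = finprod N (\<lambda>i. h (x i) \<star>\<^bsub>N\<^esub> \<phi> i m) {..<n}"
      using D(2) \<phi>D(2) m rmodule_homD(2,4)[OF h] by (intro N.finprod_cong') auto
    finally show ?thesis .
  qed
  have "finprod N (\<lambda>i. f (x i) \<star>\<^bsub>N\<^esub> \<phi> i m) {..<n} = finprod N (\<lambda>i. g (x i) \<star>\<^bsub>N\<^esub> \<phi> i m) {..<n}"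
    using eq x D(2) \<phi>D(2) m rmodule_homD(2)[OF g] by (intro N.finprod_cong') auto
  then show ?thesis using *[OF f] *[OF g] by simp
qed

text \<open>
  The extension is \<open>m \<mapsto> \<Sum>\<^sub>i h(x\<^sub>i) \<phi>\<^sub>i(m)\<close>. It agrees with \<open>h\<close> on \<open>M\<alpha>\<close> because there the \<open>\<phi>\<^sub>i\<close> take
  values in \<open>\<alpha>R\<alpha>\<close>, so that \<open>h\<close> commutes with these coefficients.
\<close>

lemma corner_hom_extend:
  assumes M: "corner_generated M" and N: "rmodule R N"
    and h: "h \<in> rmodule_hom S (corner_rmodule M) (corner_rmodule N)"
  obtains H where "H \<in> rmodule_hom R M N" "\<And>y. y \<in> corner_set M \<Longrightarrow> H y = h y"
proof -
  from M interpret M: rmodule R M by (simp add: corner_generated_def)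
  interpret N: rmodule R N by fact
  interpret CM: rmodule S "corner_rmodule M" by (rule rmodule_corner) (rule M.rmodule_axioms)
  interpret CN: rmodule S "corner_rmodule N" by (rule rmodule_corner) (rule N)
  obtain n :: nat and x \<phi> where db: "dual_basis R M {..<n} x \<phi>"
    and dbS: "dual_basis S (corner_rmodule M) {..<n} x \<phi>"
    by (rule corner_generated_dual_basis[OF M])
  note D = dual_basisD[OF db] and DS = dual_basisD[OF dbS, simplified]
  note hD = rmodule_homD[OF h, simplified] and \<phi>S = rmodule_homD[OF DS(3), simplified]
  define H where "H = (\<lambda>m. finprod N (\<lambda>i. h (x i) \<star>\<^bsub>N\<^esub> \<phi> i m) {..<n})"
  have hx: "h (x i) \<in> corner_set N" "h (x i) \<in> carrier N" if "i < n" for i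
    using hD(2)[OF DS(2)] that by (auto simp: corner_set_def)
  have "H \<in> rmodule_hom R M N"
    unfolding H_def using D(3) hx(2) by (intro finprod_ract_hom M.rmodule_axioms N) auto
  moreover have "H y = h y" if y: "y \<in> corner_set M" for y
  proof -
    have xy: "x i \<star>\<^bsub>M\<^esub> \<phi> i y \<in> corner_set M" if "i < n" for i
      using CM.ract_closed[of "x i" "\<phi> i y"] DS(2) \<phi>S(2)[of i y] y that by auto
    have "\<phi> i y \<in> carrier R" if "i < n" for i
      using \<phi>S(2)[of i y] y that corner_ring_subset by auto
    note \<phi>R = this
    have "h y = h (finprod (corner_rmodule M) (\<lambda>i. x i \<star>\<^bsub>M\<^esub> \<phi> i y) {..<n})"
      using DS(4)[OF y] by simp
    also have "\<dots> = finprod N (\<lambda>i. h (x i \<star>\<^bsub>M\<^esub> \<phi> i y)) {..<n}"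
    proof (rule N.hom_finprod)
      show "h \<in> hom (corner_rmodule M) N"
        using hD by (intro homI) (auto simp: corner_set_def)
      show "h \<one>\<^bsub>corner_rmodule M\<^esub> = \<one>\<^bsub>N\<^esub>"
        using rmodule_hom_one[OF h CM.rmodule_axioms CN.rmodule_axioms] by simp
    qed (use xy in \<open>auto intro: CM.comm_monoid_axioms\<close>)
    also have "\<dots> = H y"
      unfolding H_def using hx hD(4) DS(2) \<phi>S(2) y \<phi>R
      by (intro N.finprod_cong') auto
    finally show ?thesis by simp
  qed
  ultimately show thesis using that by blast
qed

text \<open>
  A homomorphism on the corner \<open>M\<alpha>\<close> extends uniquely to \<open>M\<close>, so that an isomorphism of corners
  and its inverse extend to mutually inverse maps.
\<close>

lemma corner_reflects_iso:
  assumes M: "corner_generated M" and N: "corner_generated N"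
    and iso: "rmodule_iso S (corner_rmodule M) (corner_rmodule N)"
  shows "rmodule_iso R M N"
proof -
  from M N have Mm: "rmodule R M" and Nm: "rmodule R N" by (simp_all add: corner_generated_def)
  obtain f g where fg: "f \<in> rmodule_hom S (corner_rmodule M) (corner_rmodule N)"
    "g \<in> rmodule_hom S (corner_rmodule N) (corner_rmodule M)"
    "\<And>x. x \<in> corner_set M \<Longrightarrow> g (f x) = x" "\<And>y. y \<in> corner_set N \<Longrightarrow> f (g y) = y"
    using rmodule_isoE[OF iso rmodule_corner[OF Mm]] by (metis corner_rmodule_simps(1))
  obtain F where F: "F \<in> rmodule_hom R M N" "\<And>y. y \<in> corner_set M \<Longrightarrow> F y = f y"
    using corner_hom_extend[OF M Nm fg(1)] by blast
  obtain G where G: "G \<in> rmodule_hom R N M" "\<And>y. y \<in> corner_set N \<Longrightarrow> G y = g y"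
    using corner_hom_extend[OF N Mm fg(2)] by blast
  show ?thesis
  proof (rule rmodule_isoI[OF F(1), of G])
    show "G (F x) = x" if "x \<in> carrier M" for x
      using F(2) G(2) fg rmodule_homD(2)[OF fg(1), simplified]
      by (intro corner_hom_unique[OF M Mm rmodule_hom_compose[OF F(1) G(1)] _ _ that])
        (auto intro: rmodule_homI)
    show "F (G y) = y" if "y \<in> carrier N" for y
      using F(2) G(2) fg rmodule_homD(2)[OF fg(2), simplified]
      by (intro corner_hom_unique[OF N Nm rmodule_hom_compose[OF G(1) F(1)] _ _ that])
        (auto intro: rmodule_homI)
  qed (rule rmodule_homD(2)[OF G(1)])
qed

end

section \<open>Tensor products\<close>

text \<open>
  Compatibility of the two actions on \<open>B\<close> keeps the balancing relators stable under the right
  action, which is therefore defined on the tensor product.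
\<close>

locale tensor_factors = R: rng R + P: rmodule S P + B: rmodule R B
  for S :: "('s, 'c) ring_scheme" and R :: "('r, 'd) ring_scheme"
    and P :: "('s, 'm, 'e) rmodule_scheme" and B :: "('s, 'r, 'n, 'f) bimodule_scheme" +
  assumes lact_closed: "\<lbrakk>s \<in> carrier S; b \<in> carrier B\<rbrakk> \<Longrightarrow> lact B s b \<in> carrier B"
    and lact_ract: "\<lbrakk>s \<in> carrier S; b \<in> carrier B; r \<in> carrier R\<rbrakk>
          \<Longrightarrow> lact B s (b \<star>\<^bsub>B\<^esub> r) = lact B s b \<star>\<^bsub>B\<^esub> r"
begin

abbreviation "F \<equiv> free_Abelian_group (carrier P \<times> carrier B)"
abbreviation "K \<equiv> tensor_kernel S P B"
abbreviation "T \<equiv> tensor_product S P B"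

definition cls :: "('m \<times> 'n \<Rightarrow>\<^sub>0 int) \<Rightarrow> ('m \<times> 'n \<Rightarrow>\<^sub>0 int) set" where
  "cls c = K #>\<^bsub>F\<^esub> c"

definition tensor :: "'m \<Rightarrow> 'n \<Rightarrow> ('m \<times> 'n \<Rightarrow>\<^sub>0 int) set" where
  "tensor p b = cls (frag_of (p, b))"

definition act :: "'r \<Rightarrow> ('m \<times> 'n \<Rightarrow>\<^sub>0 int) \<Rightarrow> 'm \<times> 'n \<Rightarrow>\<^sub>0 int" where
  "act r = frag_extend (\<lambda>(p, b). frag_of (p, b \<star>\<^bsub>B\<^esub> r))"

sublocale F: comm_group F by (rule abelian_free_Abelian_group)

lemma frag_diff_closed:
  "\<lbrakk>x \<in> carrier F; y \<in> carrier F\<rbrakk> \<Longrightarrow> x - y \<in> carrier F"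
  using keys_diff[of x y] by auto

lemma frag_add_closed:
  "\<lbrakk>x \<in> carrier F; y \<in> carrier F\<rbrakk> \<Longrightarrow> x + y \<in> carrier F"
  using F.m_closed[of x y] by simp

lemma frag_of_closed: "p \<in> carrier P \<Longrightarrow> b \<in> carrier B \<Longrightarrow> frag_of (p, b) \<in> carrier F"
  by (simp add: frag_of_in_free_Abelian_group del: carrier_free_Abelian_group_iff)

lemma relators_subset: "tensor_relators S P B \<subseteq> carrier F"
  unfolding tensor_relators_def
  by (auto simp del: carrier_free_Abelian_group_iff
      intro!: frag_diff_closed frag_add_closed frag_of_closed P.m_closed B.m_closed lact_closed)

sublocale K: subgroup K F
  unfolding tensor_kernel_def by (rule F.generate_is_subgroup[OF relators_subset])

lemma normal_K: "K \<lhd> F"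
  by (simp add: F.normal_iff_subgroup K.subgroup_axioms)

lemma tensor_product_simps:
  "carrier T = cls ` carrier F"
  "monoid.mult T = (<#>\<^bsub>F\<^esub>)"
  "\<one>\<^bsub>T\<^esub> = cls 0"
  "C \<star>\<^bsub>T\<^esub> r = (\<Union>c\<in>C. cls (act r c))"
proof -
  have "K #>\<^bsub>F\<^esub> \<one>\<^bsub>F\<^esub> = K" by (rule F.coset_mult_one) (rule K.subset)
  then show "\<one>\<^bsub>T\<^esub> = cls 0" by (simp add: tensor_product_def Let_def cls_def)
qed (auto simp: tensor_product_def Let_def carrier_FactGroup cls_def act_def)

lemma tensor_mult:
  "\<lbrakk>x \<in> carrier F; y \<in> carrier F\<rbrakk> \<Longrightarrow> cls x \<otimes>\<^bsub>T\<^esub> cls y = cls (x + y)"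
  using normal.rcos_sum[OF normal_K, of x y] by (simp add: tensor_product_simps cls_def)

lemma cls_eqI:
  assumes x: "x \<in> carrier F" and y: "y \<in> carrier F" and "x - y \<in> K" shows "cls x = cls y"
proof -
  have "x = (x - y) \<otimes>\<^bsub>F\<^esub> y" by simp
  then have "x \<in> cls y" unfolding cls_def using assms(3) unfolding r_coset_def by blast
  then show ?thesis
    unfolding cls_def using F.repr_independence[OF _ y K.subgroup_axioms] by blast
qed

lemma cls_memD:
  assumes "c \<in> carrier F" "x \<in> cls c" shows "x \<in> carrier F" "x - c \<in> K"
  using assms K.subset frag_add_closed[of _ c]
  by (auto simp: cls_def r_coset_def simp del: carrier_free_Abelian_group_iff)

lemma act_closed:
  assumes "r \<in> carrier R" "c \<in> carrier F" shows "act r c \<in> carrier F"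
proof -
  have "Poly_Mapping.keys c \<subseteq> carrier P \<times> carrier B" using assms(2) by simp
  then show ?thesis
  proof (induction c rule: free_Abelian_group_induct [consumes 1])
    case 2
    then show ?case
      by (simp add: act_def frag_extend_diff frag_diff_closed del: carrier_free_Abelian_group_iff)
  next
    case (3 a)
    then show ?case
      using assms(1)
      by (auto simp: act_def intro!: frag_of_closed simp del: carrier_free_Abelian_group_iff)
  qed (simp add: act_def)
qed

text \<open>
  The action of \<open>r\<close> on formal sums maps relators to relators, and therefore descends to cosets.
\<close>

lemma act_K:
  assumes r: "r \<in> carrier R" and "c \<in> K" shows "act r c \<in> K"
proof -
  have rel: "act r d \<in> K" if "d \<in> tensor_relators S P B" for d
    using that[unfolded tensor_relators_def]
  proof (elim UnE)
    assume "d \<in> {frag_of (p \<otimes>\<^bsub>P\<^esub> p', b) - (frag_of (p, b) + frag_of (p', b)) | p p' b.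
        p \<in> carrier P \<and> p' \<in> carrier P \<and> b \<in> carrier B}"
    then show ?thesis
      using r unfolding tensor_kernel_def
      by (intro generate.incl)
        (fastforce simp: act_def frag_extend_diff frag_extend_add tensor_relators_def)
  next
    assume "d \<in> {frag_of (p, b \<otimes>\<^bsub>B\<^esub> b') - (frag_of (p, b) + frag_of (p, b')) | p b b'.
        p \<in> carrier P \<and> b \<in> carrier B \<and> b' \<in> carrier B}"
    then show ?thesis
      using r unfolding tensor_kernel_def
      by (intro generate.incl)
        (fastforce simp: act_def frag_extend_diff frag_extend_add tensor_relators_def B.ract_mult)
  next
    assume "d \<in> {frag_of (p \<star>\<^bsub>P\<^esub> s, b) - frag_of (p, lact B s b) | p s b.
        p \<in> carrier P \<and> s \<in> carrier S \<and> b \<in> carrier B}"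
    then obtain p s b where d: "d = frag_of (p \<star>\<^bsub>P\<^esub> s, b) - frag_of (p, lact B s b)"
      "p \<in> carrier P" "s \<in> carrier S" "b \<in> carrier B" by blast
    then have "act r d = frag_of (p \<star>\<^bsub>P\<^esub> s, b \<star>\<^bsub>B\<^esub> r) - frag_of (p, lact B s (b \<star>\<^bsub>B\<^esub> r))"
      using r by (simp add: act_def frag_extend_diff lact_ract)
    then show ?thesis
      using d r unfolding tensor_kernel_def tensor_relators_def
      by (intro generate.incl) (blast intro: B.ract_closed)
  qed
  show ?thesis
    using assms(2)[unfolded tensor_kernel_def]
  proof (induction c rule: generate.induct)
    case one
    then show ?case using K.one_closed by (simp add: act_def)
  next
    case (incl h)
    then show ?case by (rule rel)
  next
    case (inv h)
    then have h: "h \<in> carrier F" using relators_subset by blast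
    then have "act r (inv\<^bsub>F\<^esub> h) = inv\<^bsub>F\<^esub> (act r h)"
      using act_closed[OF r h] by (simp add: act_def frag_extend_minus)
    then show ?case using rel[OF inv] by (simp add: K.m_inv_closed)
  next
    case (eng h1 h2)
    then show ?case
      using K.m_closed[of "act r h1" "act r h2"] by (simp add: act_def frag_extend_add)
  qed
qed

text \<open>
  All elements of a coset have images in the same coset, so the union in the definition of
  the action collapses.
\<close>

lemma tensor_ract:
  assumes r: "r \<in> carrier R" and c: "c \<in> carrier F"
  shows "cls c \<star>\<^bsub>T\<^esub> r = cls (act r c)"
proof -
  have eq: "cls (act r x) = cls (act r c)" if "x \<in> cls c" for x
  proof (rule cls_eqI)
    show "act r x - act r c \<in> K"
      using act_K[OF r cls_memD(2)[OF c that]] by (simp add: act_def frag_extend_diff)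
  qed (use act_closed[OF r] cls_memD(1)[OF c that] c in auto)
  have "c \<in> cls c"
    unfolding cls_def by (rule F.rcos_self[OF c K.subgroup_axioms])
  then have "(\<Union>x\<in>cls c. cls (act r x)) = cls (act r c)"
    by (intro SUP_eq_const eq) auto
  then show ?thesis by (simp only: tensor_product_simps(4))
qed

lemma comm_group_tensor: "comm_group T"
proof -
  interpret Q: comm_group "F Mod K" by (rule F.abelian_FactGroup[OF K.subgroup_axioms])
  have eqs: "carrier T = carrier (F Mod K)" "monoid.mult T = monoid.mult (F Mod K)"
    "\<one>\<^bsub>T\<^esub> = \<one>\<^bsub>F Mod K\<^esub>"
    by (simp_all add: tensor_product_def Let_def)
  show ?thesis
    by (rule comm_groupI; unfold eqs) (auto simp: Q.m_ac simp del: mult_FactGroup one_FactGroup)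
qed

sublocale T: comm_group T by (rule comm_group_tensor)

lemma cls_closed: "c \<in> carrier F \<Longrightarrow> cls c \<in> carrier T"
  by (simp add: tensor_product_simps)

lemma tensor_closed: "\<lbrakk>p \<in> carrier P; b \<in> carrier B\<rbrakk> \<Longrightarrow> tensor p b \<in> carrier T"
  unfolding tensor_def by (intro cls_closed frag_of_closed)

lemma tensor_add_left:
  assumes "p \<in> carrier P" "p' \<in> carrier P" "b \<in> carrier B"
  shows "tensor (p \<otimes>\<^bsub>P\<^esub> p') b = tensor p b \<otimes>\<^bsub>T\<^esub> tensor p' b"
proof -
  have "frag_of (p \<otimes>\<^bsub>P\<^esub> p', b) - (frag_of (p, b) + frag_of (p', b)) \<in> K"
    unfolding tensor_kernel_def tensor_relators_def using assms by (intro generate.incl) blast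
  then have "cls (frag_of (p \<otimes>\<^bsub>P\<^esub> p', b)) = cls (frag_of (p, b) + frag_of (p', b))"
    using assms by (intro cls_eqI frag_of_closed frag_add_closed P.m_closed)
  then show ?thesis
    using assms by (simp add: tensor_def tensor_mult frag_of_closed del: carrier_free_Abelian_group_iff)
qed

lemma tensor_add_right:
  assumes "p \<in> carrier P" "b \<in> carrier B" "b' \<in> carrier B"
  shows "tensor p (b \<otimes>\<^bsub>B\<^esub> b') = tensor p b \<otimes>\<^bsub>T\<^esub> tensor p b'"
proof -
  have "frag_of (p, b \<otimes>\<^bsub>B\<^esub> b') - (frag_of (p, b) + frag_of (p, b')) \<in> K"
    unfolding tensor_kernel_def tensor_relators_def using assms by (intro generate.incl) blast
  then have "cls (frag_of (p, b \<otimes>\<^bsub>B\<^esub> b')) = cls (frag_of (p, b) + frag_of (p, b'))"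
    using assms by (intro cls_eqI frag_of_closed frag_add_closed B.m_closed)
  then show ?thesis
    using assms by (simp add: tensor_def tensor_mult frag_of_closed del: carrier_free_Abelian_group_iff)
qed

lemma tensor_balanced:
  assumes "p \<in> carrier P" "s \<in> carrier S" "b \<in> carrier B"
  shows "tensor (p \<star>\<^bsub>P\<^esub> s) b = tensor p (lact B s b)"
  unfolding tensor_def
proof (rule cls_eqI)
  show "frag_of (p \<star>\<^bsub>P\<^esub> s, b) - frag_of (p, lact B s b) \<in> K"
    unfolding tensor_kernel_def tensor_relators_def using assms by (intro generate.incl) blast
qed (use assms in \<open>auto intro!: frag_of_closed lact_closed simp del: carrier_free_Abelian_group_iff\<close>)

lemma tensor_ract_pure:
  assumes "p \<in> carrier P" "b \<in> carrier B" "r \<in> carrier R"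
  shows "tensor p b \<star>\<^bsub>T\<^esub> r = tensor p (b \<star>\<^bsub>B\<^esub> r)"
  using assms by (simp add: tensor_def tensor_ract act_def frag_of_closed
      del: carrier_free_Abelian_group_iff)

lemma cls_hom: "cls \<in> hom F T"
  by (rule homI) (simp_all add: cls_closed tensor_mult del: carrier_free_Abelian_group_iff)

text \<open>
  Pure tensors generate the tensor product. Identities between additive maps, such as
  distributivity of the action and the dual basis equation below, need checking only on them.
\<close>

lemma tensor_hom_unique:
  assumes N: "group N" and h: "h \<in> hom T N" and k: "k \<in> hom T N"
    and eq: "\<And>p b. \<lbrakk>p \<in> carrier P; b \<in> carrier B\<rbrakk> \<Longrightarrow> h (tensor p b) = k (tensor p b)"
    and C: "C \<in> carrier T"
  shows "h C = k C"
proof -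
  obtain c where c: "c \<in> carrier F" "C = cls c" using C unfolding tensor_product_simps(1) by blast
  define h' k' where "h' = (\<lambda>c. h (cls c))" and "k' = (\<lambda>c. k (cls c))"
  have "(\<lambda>c. h (cls c)) \<in> hom F N" "(\<lambda>c. k (cls c)) \<in> hom F N"
    using hom_compose[OF cls_hom h] hom_compose[OF cls_hom k] by (simp_all add: o_def)
  then interpret h': group_hom F N h' + k': group_hom F N k'
    using N by (simp_all add: group_hom_def group_hom_axioms_def F.is_group h'_def k'_def)
  have diff: "x - y = x \<otimes>\<^bsub>F\<^esub> inv\<^bsub>F\<^esub> y" if "y \<in> carrier F" for x y using that by simp
  have "Poly_Mapping.keys c \<subseteq> carrier P \<times> carrier B" using c(1) by simp
  then have "h' c = k' c"
  proof (induction c rule: free_Abelian_group_induct [consumes 1])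
    case 1
    then show ?case using h'.hom_one k'.hom_one by simp
  next
    case (2 x y)
    then have xy: "x \<in> carrier F" "y \<in> carrier F" by simp_all
    show ?case
      unfolding diff[OF xy(2)]
      using xy 2(3,4) h'.hom_mult[of x "inv\<^bsub>F\<^esub> y"] k'.hom_mult[of x "inv\<^bsub>F\<^esub> y"]
        h'.hom_inv[of y] k'.hom_inv[of y] F.inv_closed[of y]
      by (simp del: carrier_free_Abelian_group_iff inv_free_Abelian_group mult_free_Abelian_group)
  next
    case (3 a)
    then show ?case using eq by (auto simp: h'_def k'_def tensor_def)
  qed
  then show ?thesis by (simp add: c(2) h'_def k'_def)
qed

lemma rmodule_tensor: "rmodule R T"
proof (intro rmodule.intro rmodule_axioms.intro comm_group_tensor)
  note del = carrier_free_Abelian_group_iff[simp del]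
  show cl: "C \<star>\<^bsub>T\<^esub> r \<in> carrier T" if "C \<in> carrier T" "r \<in> carrier R" for C r
    using that act_closed by (auto simp: tensor_product_simps(1) tensor_ract)
  show add: "(C \<otimes>\<^bsub>T\<^esub> D) \<star>\<^bsub>T\<^esub> r = C \<star>\<^bsub>T\<^esub> r \<otimes>\<^bsub>T\<^esub> D \<star>\<^bsub>T\<^esub> r"
    if "C \<in> carrier T" "D \<in> carrier T" "r \<in> carrier R" for C D r
    using that act_closed frag_add_closed
    by (auto simp: tensor_product_simps(1) tensor_ract tensor_mult act_def frag_extend_add)
  have hom: "(\<lambda>C. C \<star>\<^bsub>T\<^esub> r) \<in> hom T T" if "r \<in> carrier R" for r
    using that cl add by (intro homI) auto
  show "C \<star>\<^bsub>T\<^esub> (r \<oplus>\<^bsub>R\<^esub> s) = C \<star>\<^bsub>T\<^esub> r \<otimes>\<^bsub>T\<^esub> C \<star>\<^bsub>T\<^esub> s"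
    if C: "C \<in> carrier T" and rs: "r \<in> carrier R" "s \<in> carrier R" for C r s
  proof (rule tensor_hom_unique[OF T.is_group _ _ _ C])
    show "(\<lambda>C. C \<star>\<^bsub>T\<^esub> (r \<oplus>\<^bsub>R\<^esub> s)) \<in> hom T T" using rs by (intro hom) simp
    show "(\<lambda>C. C \<star>\<^bsub>T\<^esub> r \<otimes>\<^bsub>T\<^esub> C \<star>\<^bsub>T\<^esub> s) \<in> hom T T"
      using rs by (intro homI) (simp_all add: cl add T.m_ac)
  qed (use rs in \<open>simp add: tensor_ract_pure B.ract_add tensor_add_right\<close>)
  show "C \<star>\<^bsub>T\<^esub> (r \<otimes>\<^bsub>R\<^esub> s) = (C \<star>\<^bsub>T\<^esub> r) \<star>\<^bsub>T\<^esub> s"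
    if C: "C \<in> carrier T" and rs: "r \<in> carrier R" "s \<in> carrier R" for C r s
  proof (rule tensor_hom_unique[OF T.is_group _ _ _ C])
    show "(\<lambda>C. C \<star>\<^bsub>T\<^esub> (r \<otimes>\<^bsub>R\<^esub> s)) \<in> hom T T" using rs by (intro hom R.rng_m_closed)
    show "(\<lambda>C. (C \<star>\<^bsub>T\<^esub> r) \<star>\<^bsub>T\<^esub> s) \<in> hom T T"
      using rs by (intro homI) (simp_all add: cl add)
  qed (use rs in \<open>simp add: tensor_ract_pure B.ract_ract R.rng_m_closed\<close>)
qed

text \<open>
  The induced map is additive by construction; it is \<open>R\<close>-linear because \<open>C \<mapsto> h(C r)\<close> and
  \<open>C \<mapsto> h(C) r\<close> agree on pure tensors.
\<close>

lemma tensor_universal: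
  assumes N: "rmodule R N"
    and cl: "\<And>p b. \<lbrakk>p \<in> carrier P; b \<in> carrier B\<rbrakk> \<Longrightarrow> f p b \<in> carrier N"
    and left: "\<And>p p' b. \<lbrakk>p \<in> carrier P; p' \<in> carrier P; b \<in> carrier B\<rbrakk>
          \<Longrightarrow> f (p \<otimes>\<^bsub>P\<^esub> p') b = f p b \<otimes>\<^bsub>N\<^esub> f p' b"
    and right: "\<And>p b b'. \<lbrakk>p \<in> carrier P; b \<in> carrier B; b' \<in> carrier B\<rbrakk>
          \<Longrightarrow> f p (b \<otimes>\<^bsub>B\<^esub> b') = f p b \<otimes>\<^bsub>N\<^esub> f p b'"
    and balanced: "\<And>p s b. \<lbrakk>p \<in> carrier P; s \<in> carrier S; b \<in> carrier B\<rbrakk>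
          \<Longrightarrow> f (p \<star>\<^bsub>P\<^esub> s) b = f p (lact B s b)"
    and linear: "\<And>p b r. \<lbrakk>p \<in> carrier P; b \<in> carrier B; r \<in> carrier R\<rbrakk>
          \<Longrightarrow> f p (b \<star>\<^bsub>B\<^esub> r) = f p b \<star>\<^bsub>N\<^esub> r"
  obtains h where "h \<in> rmodule_hom R T N"
    "\<And>p b. \<lbrakk>p \<in> carrier P; b \<in> carrier B\<rbrakk> \<Longrightarrow> h (tensor p b) = f p b"
proof -
  note [simp del] = carrier_free_Abelian_group_iff
  interpret N: rmodule R N by fact
  interpret T: rmodule R T by (rule rmodule_tensor)
  have "(\<lambda>(p, b). f p b) ` (carrier P \<times> carrier B) \<subseteq> carrier N" using cl by auto
  then obtain k where k: "k \<in> hom F N"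
    and kf: "\<And>x. x \<in> carrier P \<times> carrier B \<Longrightarrow> k (frag_of x) = (\<lambda>(p, b). f p b) x"
    using N.free_Abelian_group_universal by metis
  interpret k: group_hom F N k
    using k by (simp add: group_hom_def group_hom_axioms_def F.is_group N.is_group)
  have kp: "k (frag_of (p, b)) = f p b" if "p \<in> carrier P" "b \<in> carrier B" for p b
    using kf[of "(p, b)"] that by simp
  have kadd: "k (x + y) = k x \<otimes>\<^bsub>N\<^esub> k y" if "x \<in> carrier F" "y \<in> carrier F" for x y
    using k.hom_mult[OF that] by simp
  have keq: "k (x - y) = \<one>\<^bsub>N\<^esub> \<longleftrightarrow> k x = k y" if "x \<in> carrier F" "y \<in> carrier F" for x y
  proof -
    have "k x = k (x - y) \<otimes>\<^bsub>N\<^esub> k y" using kadd[of "x - y" y] that frag_diff_closed by simp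
    then show ?thesis using that frag_diff_closed[OF that] by (auto simp: k.hom_closed)
  qed
  have "tensor_relators S P B \<subseteq> kernel F N k"
  proof
    fix d assume d: "d \<in> tensor_relators S P B"
    then have "k d = \<one>\<^bsub>N\<^esub>"
      unfolding tensor_relators_def
      by (elim UnE; clarsimp)
        (simp_all add: keq kadd kp frag_of_closed frag_add_closed left right balanced lact_closed)
    then show "d \<in> kernel F N k" using d relators_subset by (auto simp: kernel_def)
  qed
  then have K: "K \<subseteq> kernel F N k"
    unfolding tensor_kernel_def by (rule F.generate_subgroup_incl) (rule k.subgroup_kernel)
  have "k x = k y" if xy: "x \<in> carrier F" "y \<in> carrier F" "cls x = cls y" for x y
  proof -
    have "x \<in> cls y"
      using F.rcos_self[OF xy(1) K.subgroup_axioms] xy(3) by (simp add: cls_def)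
    then have "x - y \<in> K" by (rule cls_memD(2)[OF xy(2)])
    then show ?thesis using K keq[OF xy(1,2)] by (auto simp: kernel_def)
  qed
  then obtain h where h: "\<And>x. x \<in> carrier F \<Longrightarrow> h (cls x) = k x"
    using function_factors_left_gen[of "\<lambda>x. x \<in> carrier F" cls k] by metis
  have hT: "h \<in> hom T N"
    by (rule homI) (auto simp: tensor_product_simps(1) tensor_mult h kadd frag_add_closed k.hom_closed)
  have hp: "h (tensor p b) = f p b" if "p \<in> carrier P" "b \<in> carrier B" for p b
    using that by (simp add: tensor_def h frag_of_closed kp)
  have "h (C \<star>\<^bsub>T\<^esub> r) = h C \<star>\<^bsub>N\<^esub> r" if C: "C \<in> carrier T" and r: "r \<in> carrier R" for C r
  proof (rule tensor_hom_unique[OF N.is_group _ _ _ C])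
    show "(\<lambda>C. h (C \<star>\<^bsub>T\<^esub> r)) \<in> hom T N" "(\<lambda>C. h C \<star>\<^bsub>N\<^esub> r) \<in> hom T N"
      using hom_compose[OF T.ract_hom[OF r] hT] hom_compose[OF hT N.ract_hom[OF r]]
      by (simp_all add: o_def)
  qed (use r in \<open>simp add: tensor_ract_pure hp linear\<close>)
  then have "h \<in> rmodule_hom R T N"
    using hT by (simp add: rmodule_hom_def)
  then show thesis using hp that by blast
qed

end

section \<open>Induction from a corner\<close>

context idempotent_rng begin

lemma tensor_factors_corner: "rmodule S P \<Longrightarrow> tensor_factors S R P B"
  by (intro tensor_factors.intro tensor_factors_axioms.intro rng_axioms rmodule_corner_bimodule)
    (auto simp: corner_bimodule_carrier corner_ring_carrier rng_m_assoc rng_m_closed,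
     simp add: rng_m_assoc[symmetric])

text \<open>
  Let \<open>x\<^sub>i\<close>, \<open>\<phi>\<^sub>i\<close> be a dual basis of \<open>P\<close> over \<open>S\<close>. Then \<open>x\<^sub>i \<otimes> \<alpha>\<close> with the forms
  \<open>\<psi>\<^sub>i(p \<otimes> b) = \<phi>\<^sub>i(p) b\<close> is a dual basis of \<open>P \<otimes> B\<close>, because
  \<open>\<Sum>\<^sub>i (x\<^sub>i \<otimes> \<alpha>) \<phi>\<^sub>i(p) b = \<Sum>\<^sub>i x\<^sub>i \<phi>\<^sub>i(p) \<otimes> b = p \<otimes> b\<close>. The inverse of \<open>p \<mapsto> p \<otimes> \<alpha>\<close> on the corner is
  \<open>C \<mapsto> \<Sum>\<^sub>i x\<^sub>i \<psi>\<^sub>i(C)\<close>; here \<open>\<psi>\<^sub>i(C) \<in> S\<close> since \<open>C = C\<alpha>\<close> and \<open>\<psi>\<^sub>i\<close> maps into \<open>\<alpha>R\<close>.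
\<close>

theorem tensor_corner:
  assumes P: "fg_projective S P"
  shows "corner_generated (tensor_product S P B)"
    and "rmodule_iso S P (corner_rmodule (tensor_product S P B))"
proof -
  interpret P: rmodule S P by (rule fg_projective_rmodule[OF P])
  interpret tensor_factors S R P B by (rule tensor_factors_corner[OF P.rmodule_axioms])
  interpret T: rmodule R T by (rule rmodule_tensor)
  obtain n :: nat and x \<phi> where db: "dual_basis S P {..<n} x \<phi>"
    using P by (auto simp: fg_projective_iff_dual_basis[OF rng_corner] has_dual_basis_in_def)
  note D = dual_basisD[OF db] and \<phi>D = rmodule_homD[OF dual_basisD(3)[OF db], simplified]
  have \<alpha>: "\<alpha> \<in> carrier B" "\<alpha> \<in> carrier S" "\<alpha> \<in> carrier R"
    by (simp_all add: corner_bimodule_carrier corner_ring_carrier)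
  have Srule: "s \<in> carrier R \<and> s \<in> carrier B \<and> \<alpha> \<otimes> s = s \<and> s \<otimes> \<alpha> = s" if "s \<in> carrier S" for s
    using that by (simp add: corner_bimodule_carrier corner_ring_carrier)
  have "\<exists>h \<in> rmodule_hom R T B. \<forall>p\<in>carrier P. \<forall>b\<in>carrier B. h (tensor p b) = \<phi> i p \<otimes> b"
    if i: "i < n" for i
  proof -
    obtain h where "h \<in> rmodule_hom R T B"
      "\<And>p b. \<lbrakk>p \<in> carrier P; b \<in> carrier B\<rbrakk> \<Longrightarrow> h (tensor p b) = \<phi> i p \<otimes> b"
    proof (rule tensor_universal[OF rmodule_corner_bimodule, where f = "\<lambda>p b. \<phi> i p \<otimes> b"])
      show "\<phi> i p \<otimes> b \<in> carrier B" if "p \<in> carrier P" "b \<in> carrier B" for p b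
        using lact_closed[of "\<phi> i p" b] that i \<phi>D(2) by simp
    qed (use i \<phi>D Srule in \<open>auto simp: corner_bimodule_carrier rng_l_distr rng_r_distr rng_m_assoc\<close>)
    then show ?thesis by blast
  qed
  then obtain \<psi> where \<psi>: "\<And>i. i < n \<Longrightarrow> \<psi> i \<in> rmodule_hom R T B"
    and \<psi>p: "\<And>i p b. \<lbrakk>i < n; p \<in> carrier P; b \<in> carrier B\<rbrakk> \<Longrightarrow> \<psi> i (tensor p b) = \<phi> i p \<otimes> b"
    by metis
  note \<psi>D = rmodule_homD[OF \<psi>, simplified]
  have \<psi>R: "\<psi> i \<in> rmodule_hom R T (regular_rmodule R)" if "i < n" for i
    by (rule corner_bimodule_hom_regular[OF \<psi>[OF that]])
  have y: "tensor p \<alpha> \<in> corner_set T" if "p \<in> carrier P" for p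
    using that \<alpha> by (simp add: corner_set_def tensor_closed tensor_ract_pure)
  have tensor_hom: "(\<lambda>p. tensor p b) \<in> hom P T" if "b \<in> carrier B" for b
    using that by (intro homI tensor_closed tensor_add_left)
  have tensor_one: "tensor \<one>\<^bsub>P\<^esub> b = \<one>\<^bsub>T\<^esub>" if "b \<in> carrier B" for b
    using hom_one[OF tensor_hom[OF that] P.is_group T.is_group] .
  have sum: "finprod T (\<lambda>i. tensor (x i) \<alpha> \<star>\<^bsub>T\<^esub> \<psi> i C) {..<n} = C" if C: "C \<in> carrier T" for C
  proof (rule tensor_hom_unique[OF T.is_group _ _ _ C])
    show "(\<lambda>C. finprod T (\<lambda>i. tensor (x i) \<alpha> \<star>\<^bsub>T\<^esub> \<psi> i C) {..<n}) \<in> hom T T"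
      using D(2) \<alpha> \<psi>R tensor_closed
      by (intro rmodule_homD(1)[OF finprod_ract_hom[OF rmodule_tensor rmodule_tensor]]) auto
    show "(\<lambda>C. C) \<in> hom T T" by (rule homI) auto
    fix p b assume pb: "p \<in> carrier P" "b \<in> carrier B"
    have \<phi>b: "\<phi> i p \<otimes> b \<in> carrier R" "\<alpha> \<otimes> (\<phi> i p \<otimes> b) = \<phi> i p \<otimes> b" if "i < n" for i
      using lact_closed[of "\<phi> i p" b] that \<phi>D(2) pb by (simp_all add: corner_bimodule_carrier)
    have "finprod T (\<lambda>i. tensor (x i) \<alpha> \<star>\<^bsub>T\<^esub> \<psi> i (tensor p b)) {..<n}
        = finprod T (\<lambda>i. tensor (x i \<star>\<^bsub>P\<^esub> \<phi> i p) b) {..<n}"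
      using pb D(2) \<phi>D(2) \<phi>b \<alpha>
      by (intro T.finprod_cong')
        (auto simp: \<psi>p tensor_ract_pure tensor_balanced intro!: tensor_closed lact_closed[simplified])
    also have "\<dots> = tensor (finprod P (\<lambda>i. x i \<star>\<^bsub>P\<^esub> \<phi> i p) {..<n}) b"
      using pb D(2) \<phi>D(2) tensor_one
      by (intro T.hom_finprod[symmetric] tensor_hom) (auto intro: P.comm_monoid_axioms)
    finally show "finprod T (\<lambda>i. tensor (x i) \<alpha> \<star>\<^bsub>T\<^esub> \<psi> i (tensor p b)) {..<n} = tensor p b"
      using D(4)[OF pb(1)] by simp
  qed
  have "dual_basis R T {..<n} (\<lambda>i. tensor (x i) \<alpha>) \<psi>"
    using y D(2) \<psi>R sum unfolding dual_basis_def by (auto simp: corner_set_def)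
  then show "corner_generated T"
    unfolding corner_generated_def has_dual_basis_in_def
    using rmodule_tensor y D(2) by blast
  show "rmodule_iso S P (corner_rmodule T)"
  proof (rule rmodule_isoI[where f = "\<lambda>p. tensor p \<alpha>"
        and g = "\<lambda>C. finprod P (\<lambda>i. x i \<star>\<^bsub>P\<^esub> \<psi> i C) {..<n}"])
    have lin: "tensor (p \<star>\<^bsub>P\<^esub> s) \<alpha> = tensor p \<alpha> \<star>\<^bsub>T\<^esub> s" if "p \<in> carrier P" "s \<in> carrier S" for p s
      using that \<alpha> Srule[of s] by (simp add: tensor_balanced tensor_ract_pure)
    then show "(\<lambda>p. tensor p \<alpha>) \<in> rmodule_hom S P (corner_rmodule T)"
      using y \<alpha> by (intro rmodule_homI) (simp_all add: tensor_add_left)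
    have \<psi>S: "\<psi> i C \<in> carrier S" if "i < n" "C \<in> corner_set T" for i C
      using \<psi>D(2)[of i C] \<psi>D(4)[of i C \<alpha>] that
      by (auto simp: corner_set_def corner_ring_carrier corner_bimodule_carrier)
    then have cl: "x i \<star>\<^bsub>P\<^esub> \<psi> i C \<in> carrier P" if "i < n" "C \<in> corner_set T" for i C
      using that D(2) by auto
    then show "finprod P (\<lambda>i. x i \<star>\<^bsub>P\<^esub> \<psi> i C) {..<n} \<in> carrier P"
      if "C \<in> carrier (corner_rmodule T)" for C
      using that by auto
    show "finprod P (\<lambda>i. x i \<star>\<^bsub>P\<^esub> \<psi> i (tensor p \<alpha>)) {..<n} = p" if p: "p \<in> carrier P" for p
    proof -
      have "finprod P (\<lambda>i. x i \<star>\<^bsub>P\<^esub> \<psi> i (tensor p \<alpha>)) {..<n}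
          = finprod P (\<lambda>i. x i \<star>\<^bsub>P\<^esub> \<phi> i p) {..<n}"
        using p D(2) \<phi>D(2) Srule \<alpha> by (intro P.finprod_cong') (auto simp: \<psi>p)
      then show ?thesis using D(4)[OF p] by simp
    qed
    show "tensor (finprod P (\<lambda>i. x i \<star>\<^bsub>P\<^esub> \<psi> i C) {..<n}) \<alpha> = C"
      if "C \<in> carrier (corner_rmodule T)" for C
    proof -
      from that have C: "C \<in> corner_set T" by simp
      have "tensor (finprod P (\<lambda>i. x i \<star>\<^bsub>P\<^esub> \<psi> i C) {..<n}) \<alpha>
          = finprod T (\<lambda>i. tensor (x i \<star>\<^bsub>P\<^esub> \<psi> i C) \<alpha>) {..<n}"
        using C cl \<alpha> tensor_one
        by (intro T.hom_finprod tensor_hom) (auto intro: P.comm_monoid_axioms)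
      also have "\<dots> = finprod T (\<lambda>i. tensor (x i) \<alpha> \<star>\<^bsub>T\<^esub> \<psi> i C) {..<n}"
        using C D(2) \<psi>S Srule \<alpha>
        by (intro T.finprod_cong') (auto simp: lin intro!: T.ract_closed tensor_closed)
      also have "\<dots> = C" using sum C by (simp add: corner_set_def)
      finally show ?thesis .
    qed
  qed
qed

end

section \<open>The closure of the semigroup generated by the corner bimodule\<close>

context idempotent_rng begin

text \<open>
  Corner generated modules are determined by their corners, so the tensor product may be replaced by
  any corner generated module with the right corner.
\<close>

lemma V_tensor_iso_class:
  assumes P: "fg_projective S P" and N: "corner_generated N"
    and iso: "rmodule_iso S P (corner_rmodule N)"
  shows "V_tensor S R B (iso_class S P) = iso_class R N"
proof -
  have "iso_class R (tensor_product S P' B) = iso_class R N" if P': "P' \<in> iso_class S P" for P'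
  proof -
    note T = tensor_corner[OF iso_classD(1)[OF P']]
    have "rmodule_iso S (corner_rmodule (tensor_product S P' B)) P'"
      by (rule rmodule_iso_sym[OF T(2) iso_classD(2)[OF P']])
    then have "rmodule_iso S (corner_rmodule (tensor_product S P' B)) (corner_rmodule N)"
      by (meson rmodule_iso_trans iso_classD(3)[OF P'] iso)
    then have "rmodule_iso R (tensor_product S P' B) N"
      by (rule corner_reflects_iso[OF T(1) N])
    then show ?thesis
      using T(1) by (intro iso_class_eqI) (simp_all add: corner_generated_def)
  qed
  moreover obtain P' where "P' \<in> iso_class S P" using iso_class_nonempty[OF rng_corner P] .
  ultimately show ?thesis unfolding V_tensor_def by blast
qed

lemma V_tensor_tensor:
  assumes "fg_projective S P"
  shows "V_tensor S R B (iso_class S P) = iso_class R (tensor_product S P B)"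
  by (rule V_tensor_iso_class[OF assms tensor_corner[OF assms]])

lemma V_tensor_hom: "V_tensor S R B \<in> hom (V_monoid S) (V_monoid R)"
proof (rule homI)
  fix x assume "x \<in> carrier (V_monoid S)"
  then obtain P :: "('a, nat \<Rightarrow> 'a) rmodule" where P: "fg_projective S P" "x = iso_class S P" by (rule V_monoid_carrierE)
  then show "V_tensor S R B x \<in> carrier (V_monoid R)"
    using tensor_corner(1)[OF P(1)]
    by (simp add: V_tensor_tensor iso_class_in_V_monoid rng_axioms corner_generated_fg_projective)
next
  fix x y assume "x \<in> carrier (V_monoid S)" "y \<in> carrier (V_monoid S)"
  then obtain P Q :: "('a, nat \<Rightarrow> 'a) rmodule" where P: "fg_projective S P" "x = iso_class S P"
    and Q: "fg_projective S Q" "y = iso_class S Q" by (metis V_monoid_carrierE)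
  let ?TP = "tensor_product S P B" and ?TQ = "tensor_product S Q B"
  note TP = tensor_corner[OF P(1)] and TQ = tensor_corner[OF Q(1)]
  note PQ = fg_projective_direct_sum[OF rng_corner P(1) Q(1)]
  have cl: "corner_generated (direct_sum ?TP ?TQ)"
    by (rule corner_generated_direct_sum[OF TP(1) TQ(1)])
  have "rmodule R (direct_sum ?TP ?TQ)" using cl by (simp add: corner_generated_def)
  then have "rmodule_iso S (direct_sum (corner_rmodule ?TP) (corner_rmodule ?TQ))
      (corner_rmodule (direct_sum ?TP ?TQ))"
    by (intro rmodule_iso_sym[OF corner_direct_sum_iso] rmodule_corner)
  then have "rmodule_iso S (direct_sum P Q) (corner_rmodule (direct_sum ?TP ?TQ))"
    by (rule rmodule_iso_trans[OF direct_sum_iso_cong[OF TP(2) TQ(2)]])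
  from V_tensor_iso_class[OF PQ cl this]
  show "V_tensor S R B (x \<otimes>\<^bsub>V_monoid S\<^esub> y)
      = V_tensor S R B x \<otimes>\<^bsub>V_monoid R\<^esub> V_tensor S R B y"
    using P Q TP(1) TQ(1)
    by (simp add: V_monoid_mult rng_corner rng_axioms V_tensor_tensor corner_generated_fg_projective)
qed

lemma V_tensor_inj: "inj_on (V_tensor S R B) (carrier (V_monoid S))"
proof (rule inj_onI)
  fix x y assume "x \<in> carrier (V_monoid S)" "y \<in> carrier (V_monoid S)"
  then obtain P Q :: "('a, nat \<Rightarrow> 'a) rmodule" where P: "fg_projective S P" "x = iso_class S P"
    and Q: "fg_projective S Q" "y = iso_class S Q" by (metis V_monoid_carrierE)
  let ?TP = "tensor_product S P B" and ?TQ = "tensor_product S Q B"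
  note TP = tensor_corner[OF P(1)] and TQ = tensor_corner[OF Q(1)]
  assume "V_tensor S R B x = V_tensor S R B y"
  then have "iso_class R ?TP = iso_class R ?TQ" using P Q by (simp add: V_tensor_tensor)
  then have "rmodule_iso R ?TP ?TQ"
    using TP(1) by (intro iso_class_eqD rng_axioms corner_generated_fg_projective)
  then have "rmodule_iso S (corner_rmodule ?TP) (corner_rmodule ?TQ)"
    using TP(1) by (intro corner_iso) (simp_all add: corner_generated_def)
  moreover have "rmodule_iso S (corner_rmodule ?TQ) Q"
    by (rule rmodule_iso_sym[OF TQ(2) fg_projective_rmodule[OF Q(1)]])
  ultimately have "rmodule_iso S P Q" using TP(2) by (meson rmodule_iso_trans)
  then show "x = y"
    using P Q by (simp add: iso_class_eqI fg_projective_rmodule)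
qed

text \<open>
  A corner generated module \<open>M\<close> represents the image of \<open>[M\<alpha>]\<close>.
\<close>

lemma V_tensor_image:
  "V_tensor S R B ` carrier (V_monoid S)
     = {iso_class R M | M :: ('a, nat \<Rightarrow> 'a) rmodule. corner_generated M}"
proof (intro equalityI subsetI)
  fix z assume "z \<in> V_tensor S R B ` carrier (V_monoid S)"
  then obtain P :: "('a, nat \<Rightarrow> 'a) rmodule" where P: "fg_projective S P" "z = iso_class R (tensor_product S P B)"
    by (auto elim!: V_monoid_carrierE simp: V_tensor_tensor)
  obtain M where M: "M \<in> iso_class R (tensor_product S P B)"
    using iso_class_nonempty[OF rng_axioms corner_generated_fg_projective[OF tensor_corner(1)[OF P(1)]]] .
  note MD = iso_classD[OF M]
  have "rmodule_iso R (tensor_product S P B) M" by (rule rmodule_iso_sym[OF MD(3,2)])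
  then have "corner_generated M" by (rule corner_generated_iso[OF tensor_corner(1)[OF P(1)] _ MD(2)])
  moreover have "z = iso_class R M" using P(2) iso_class_eqI[OF MD(2,3)] by simp
  ultimately show "z \<in> {iso_class R M | M :: ('a, nat \<Rightarrow> 'a) rmodule. corner_generated M}" by blast
next
  fix z assume "z \<in> {iso_class R M | M :: ('a, nat \<Rightarrow> 'a) rmodule. corner_generated M}"
  then obtain M :: "('a, nat \<Rightarrow> 'a) rmodule" where M: "corner_generated M" "z = iso_class R M" by blast
  note C = fg_projective_corner[OF M(1)]
  have "V_tensor S R B (iso_class S (corner_rmodule M)) = z"
    using V_tensor_iso_class[OF C M(1) rmodule_iso_refl] M(2) by simp
  then show "z \<in> V_tensor S R B ` carrier (V_monoid S)"
    using iso_class_in_V_monoid[OF rng_corner C] by blast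
qed

lemma corner_generated_copy:
  assumes "corner_generated L"
  obtains M :: "('a, nat \<Rightarrow> 'a) rmodule" where "corner_generated M" "rmodule_iso R M L"
    "iso_class R M = iso_class R L"
proof -
  obtain M where M: "M \<in> iso_class R L"
    using iso_class_nonempty[OF rng_axioms corner_generated_fg_projective[OF assms]] .
  note MD = iso_classD[OF M]
  have "corner_generated M"
    by (rule corner_generated_iso[OF assms rmodule_iso_sym[OF MD(3,2)] MD(2)])
  then show thesis using that MD iso_class_eqI by blast
qed

text \<open>
  As \<open>[P] + [Q] = [P \<oplus> Q]\<close>, these are the classes \<open>n[B] = [B\<^sup>n]\<close> with \<open>n \<ge> 1\<close>.
\<close>

abbreviation "multiples \<equiv> subsemigroup_generated (V_monoid R) {iso_class R B}"

lemma multiples_corner_generated: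
  assumes "z \<in> multiples"
  shows "\<exists>L :: ('a, nat \<Rightarrow> 'a) rmodule. corner_generated L \<and> z = iso_class R L"
  using assms
proof induction
  case (incl z)
  then show ?case using corner_generated_copy[OF corner_generated_bimodule] by (metis singletonD)
next
  case (mult y z)
  then obtain L L' :: "('a, nat \<Rightarrow> 'a) rmodule" where
    L: "corner_generated L" "y = iso_class R L" and L': "corner_generated L'" "z = iso_class R L'"
    by blast
  have "y \<otimes>\<^bsub>V_monoid R\<^esub> z = iso_class R (direct_sum L L')"
    using L L' by (simp add: V_monoid_mult rng_axioms corner_generated_fg_projective)
  then show ?case
    using corner_generated_copy[OF corner_generated_direct_sum[OF L(1) L'(1)]] by metis
qed

text \<open>
  The map \<open>m \<mapsto> \<Sum>\<^sub>i x\<^sub>i \<phi>\<^sub>i(m)\<close> with \<open>n\<close> terms factors through \<open>B\<^sup>n\<^sup>+\<^sup>1\<close>: the section has the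
  components \<open>\<alpha>\<phi>\<^sub>i(m)\<close>, and the projection is \<open>(b\<^sub>i)\<^sub>i \<mapsto> \<Sum>\<^sub>i x\<^sub>i b\<^sub>i\<close>, where \<open>x\<^sub>i \<alpha> = x\<^sub>i\<close> gives
  \<open>x\<^sub>i \<alpha>\<phi>\<^sub>i(m) = x\<^sub>i \<phi>\<^sub>i(m)\<close>. The additional summand \<open>B\<close>, on which both maps vanish, avoids the zero
  module, whose class need not be a positive multiple of \<open>[B]\<close>.
\<close>

lemma factor_through_multiple:
  fixes M :: "('a, 'm, 'd) rmodule_scheme" and n :: nat
  assumes M: "rmodule R M"
    and "\<And>i. i < n \<Longrightarrow> x i \<in> corner_set M"
    and "\<And>i. i < n \<Longrightarrow> \<phi> i \<in> rmodule_hom R M (regular_rmodule R)"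
  shows "\<exists>(L :: ('a, nat \<Rightarrow> 'a) rmodule) p s. corner_generated L \<and> iso_class R L \<in> multiples \<and>
    p \<in> rmodule_hom R L M \<and> s \<in> rmodule_hom R M L \<and>
    (\<forall>m\<in>carrier M. p (s m) = finprod M (\<lambda>i. x i \<star>\<^bsub>M\<^esub> \<phi> i m) {..<n})"
  using assms(2,3)
proof (induction n)
  interpret M: rmodule R M by fact
  case 0
  obtain L :: "('a, nat \<Rightarrow> 'a) rmodule" where L: "corner_generated L" "iso_class R L = iso_class R B"
    using corner_generated_copy[OF corner_generated_bimodule] by metis
  then interpret L: rmodule R L by (simp add: corner_generated_def)
  have "(\<lambda>_. \<one>\<^bsub>M\<^esub>) \<in> rmodule_hom R L M" "(\<lambda>_. \<one>\<^bsub>L\<^esub>) \<in> rmodule_hom R M L"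
    by (auto intro!: rmodule_homI)
  moreover have "iso_class R L \<in> multiples"
    unfolding L(2) by (rule subsemigroup_generated.incl) simp
  ultimately show ?case
    using L(1) by (intro exI[of _ L] exI[of _ "\<lambda>_. \<one>\<^bsub>M\<^esub>"] exI[of _ "\<lambda>_. \<one>\<^bsub>L\<^esub>"]) simp
next
  case (Suc n)
  interpret M: rmodule R M by fact
  interpret B: rmodule R B by (rule rmodule_corner_bimodule)
  have "\<And>i. i < n \<Longrightarrow> x i \<in> corner_set M"
    "\<And>i. i < n \<Longrightarrow> \<phi> i \<in> rmodule_hom R M (regular_rmodule R)"
    using Suc.prems by auto
  from Suc.IH[OF this]
  obtain L :: "('a, nat \<Rightarrow> 'a) rmodule" and p s where L: "corner_generated L" "iso_class R L \<in> multiples"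
    and p: "p \<in> rmodule_hom R L M" and s: "s \<in> rmodule_hom R M L"
    and ps: "\<And>m. m \<in> carrier M \<Longrightarrow> p (s m) = finprod M (\<lambda>i. x i \<star>\<^bsub>M\<^esub> \<phi> i m) {..<n}"
    by blast
  from L interpret L: rmodule R L by (simp add: corner_generated_def)
  note pD = rmodule_homD[OF p] and sD = rmodule_homD[OF s]
  note \<phi>D = rmodule_homD[OF Suc.prems(2), simplified]
  have xn: "x i \<in> carrier M" "x i \<star>\<^bsub>M\<^esub> \<alpha> = x i" if "i < Suc n" for i
    using Suc.prems(1)[OF that] by (simp_all add: corner_set_def)
  let ?LB = "direct_sum L B"
  let ?p = "\<lambda>(y, b). p y \<otimes>\<^bsub>M\<^esub> x n \<star>\<^bsub>M\<^esub> b" and ?s = "\<lambda>m. (s m, \<alpha> \<otimes> \<phi> n m)"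
  have Bc: "b \<in> carrier R" if "b \<in> carrier B" for b
    using that by (simp add: corner_bimodule_carrier)
  have LB: "corner_generated ?LB"
    by (rule corner_generated_direct_sum[OF L(1) corner_generated_bimodule])
  obtain N :: "('a, nat \<Rightarrow> 'a) rmodule" where N: "corner_generated N" "rmodule_iso R N ?LB"
    and Ncl: "iso_class R N = iso_class R ?LB"
    by (rule corner_generated_copy[OF LB])
  have Nm: "rmodule R N" using N(1) by (simp add: corner_generated_def)
  obtain f g where f: "f \<in> rmodule_hom R N ?LB" and g: "g \<in> rmodule_hom R ?LB N"
    and fg: "\<And>w. w \<in> carrier ?LB \<Longrightarrow> f (g w) = w"
    using rmodule_isoE[OF N(2) Nm] by metis
  have p': "?p \<in> rmodule_hom R ?LB M"
    using xn(1)[of n]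
    by (intro rmodule_homI)
      (auto simp: pD Bc M.ract_add M.ract_mult M.ract_ract M.m_ac)
  have s': "?s \<in> rmodule_hom R M ?LB"
    using \<phi>D[of n]
    by (intro rmodule_homI)
      (auto simp: sD corner_bimodule_carrier rng_r_distr rng_m_assoc[symmetric] rng_m_closed)
  have "?p (f (g (?s m))) = finprod M (\<lambda>i. x i \<star>\<^bsub>M\<^esub> \<phi> i m) {..<Suc n}" if m: "m \<in> carrier M" for m
  proof -
    have "?s m \<in> carrier ?LB" using rmodule_homD(2)[OF s' m] .
    then have "?p (f (g (?s m))) = finprod M (\<lambda>i. x i \<star>\<^bsub>M\<^esub> \<phi> i m) {..<n} \<otimes>\<^bsub>M\<^esub> x n \<star>\<^bsub>M\<^esub> (\<alpha> \<otimes> \<phi> n m)"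
      using ps[OF m] by (simp only: fg) simp
    also have "x n \<star>\<^bsub>M\<^esub> (\<alpha> \<otimes> \<phi> n m) = x n \<star>\<^bsub>M\<^esub> \<phi> n m"
      using xn[of n] \<phi>D(2)[of n m] m by (simp add: M.ract_ract)
    also have "finprod M (\<lambda>i. x i \<star>\<^bsub>M\<^esub> \<phi> i m) {..<n} \<otimes>\<^bsub>M\<^esub> x n \<star>\<^bsub>M\<^esub> \<phi> n m
        = finprod M (\<lambda>i. x i \<star>\<^bsub>M\<^esub> \<phi> i m) {..<Suc n}"
      unfolding lessThan_Suc using xn(1) \<phi>D(2) m
      by (subst M.finprod_insert) (auto simp: M.m_comm Pi_iff)
    finally show ?thesis .
  qed
  moreover have "iso_class R N \<in> multiples"
  proof -
    have "iso_class R N = iso_class R L \<otimes>\<^bsub>V_monoid R\<^esub> iso_class R B"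
      unfolding Ncl using L(1) corner_generated_bimodule
      by (simp add: V_monoid_mult rng_axioms corner_generated_fg_projective)
    then show ?thesis using L(2) by (simp add: subsemigroup_generated.intros)
  qed
  ultimately show ?case
    using N(1) rmodule_hom_compose[OF f p'] rmodule_hom_compose[OF s' g]
    by (intro exI[of _ N] exI[of _ "\<lambda>w. ?p (f w)"] exI[of _ "\<lambda>m. g (?s m)"] conjI ballI)
qed

text \<open>
  A summand of a corner generated module is corner generated. Conversely, the factorization of
  the identity of \<open>M\<close> that comes from a dual basis splits \<open>M\<close> off a multiple of \<open>B\<close>.
\<close>

lemma closure_multiples:
  "semigroup_closure (V_monoid R) multiples
     = {iso_class R M | M :: ('a, nat \<Rightarrow> 'a) rmodule. corner_generated M}"
proof (intro equalityI subsetI)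
  fix z assume "z \<in> semigroup_closure (V_monoid R) multiples"
  then obtain y t where z: "z \<in> carrier (V_monoid R)" and t: "t \<in> multiples"
    and y: "y \<in> carrier (V_monoid R)" "z \<otimes>\<^bsub>V_monoid R\<^esub> y = t"
    by (auto simp: semigroup_closure_def semigroup_preorder_def)
  obtain M :: "('a, nat \<Rightarrow> 'a) rmodule" where M: "fg_projective R M" "z = iso_class R M"
    using z by (rule V_monoid_carrierE)
  obtain K :: "('a, nat \<Rightarrow> 'a) rmodule" where K: "fg_projective R K" "y = iso_class R K"
    using y(1) by (rule V_monoid_carrierE)
  obtain L :: "('a, nat \<Rightarrow> 'a) rmodule" where L: "corner_generated L" "t = iso_class R L"
    using multiples_corner_generated[OF t] by blast
  have "iso_class R (direct_sum M K) = iso_class R L"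
    using y(2) M K L by (simp add: V_monoid_mult rng_axioms)
  then have "rmodule_iso R (direct_sum M K) L"
    using M(1) K(1) by (intro iso_class_eqD fg_projective_direct_sum rng_axioms)
  then have "corner_generated M"
    by (rule corner_generated_summand[OF L(1) M(1)[THEN fg_projective_rmodule]
          K(1)[THEN fg_projective_rmodule]])
  then show "z \<in> {iso_class R M | M :: ('a, nat \<Rightarrow> 'a) rmodule. corner_generated M}"
    using M(2) by blast
next
  fix z assume "z \<in> {iso_class R M | M :: ('a, nat \<Rightarrow> 'a) rmodule. corner_generated M}"
  then obtain M :: "('a, nat \<Rightarrow> 'a) rmodule" where M: "corner_generated M" "z = iso_class R M" by blast
  then have Mm: "rmodule R M" by (simp add: corner_generated_def)
  obtain n :: nat and x \<phi> where db: "dual_basis R M {..<n} x \<phi>" and x: "x ` {..<n} \<subseteq> corner_set M"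
    using M(1) by (auto simp: corner_generated_def has_dual_basis_in_def)
  have "\<And>i. i < n \<Longrightarrow> x i \<in> corner_set M"
    "\<And>i. i < n \<Longrightarrow> \<phi> i \<in> rmodule_hom R M (regular_rmodule R)"
    using x dual_basisD(3)[OF db] by auto
  from factor_through_multiple[where n = n and x = x and \<phi> = \<phi>, OF Mm this]
  obtain L :: "('a, nat \<Rightarrow> 'a) rmodule" and p s where
    L: "corner_generated L" "iso_class R L \<in> multiples"
    and p: "p \<in> rmodule_hom R L M" and s: "s \<in> rmodule_hom R M L"
    and ps: "\<And>m. m \<in> carrier M \<Longrightarrow> p (s m) = finprod M (\<lambda>i. x i \<star>\<^bsub>M\<^esub> \<phi> i m) {..<n}"
    by blast
  have Lm: "rmodule R L" using L(1) by (simp add: corner_generated_def)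
  define K where "K = rmodule_on L {y \<in> carrier L. p y = \<one>\<^bsub>M\<^esub>}"
  have "p (s m) = m" if "m \<in> carrier M" for m
    using ps[OF that] dual_basisD(4)[OF db that] by simp
  note split = split_epi_direct_sum[where p = p and s = s, OF Lm Mm p s this, folded K_def]
  have fg: "fg_projective R M" "fg_projective R L"
    using M(1) L(1) by (simp_all add: corner_generated_fg_projective)
  have K: "fg_projective R K"
    by (rule fg_projective_complement[OF rng_axioms fg(2) Mm split])
  have "z \<otimes>\<^bsub>V_monoid R\<^esub> iso_class R K = iso_class R L"
    using M(2) fg(1) K iso_class_eqI[OF rmodule_direct_sum[OF Mm split(1)] split(2)]
    by (simp add: V_monoid_mult rng_axioms)
  then show "z \<in> semigroup_closure (V_monoid R) multiples"
    using L(2) M(2) K fg(1) iso_class_in_V_monoid[OF rng_axioms]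
    by (auto simp: semigroup_closure_def semigroup_preorder_def)
qed

end

theorem theorem15:
  fixes R :: "('a, 'c) ring_scheme" and \<alpha> :: 'a
  assumes "rng R"
    and "\<alpha> \<in> carrier R"
    and "\<alpha> \<otimes>\<^bsub>R\<^esub> \<alpha> = \<alpha>"
  defines "S \<equiv> corner_ring R \<alpha>"
    and "B \<equiv> corner_bimodule R \<alpha>"
  shows "(\<forall>P :: ('a, nat \<Rightarrow> 'a) rmodule. fg_projective S P \<longrightarrow>
            fg_projective R (tensor_product S P B) \<and>
            V_tensor S R B (iso_class S P) = iso_class R (tensor_product S P B)) \<and>
         V_tensor S R B \<in> hom (V_monoid S) (V_monoid R) \<and>
         inj_on (V_tensor S R B) (carrier (V_monoid S)) \<and>
         V_monoid S \<cong>
           V_monoid R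
             \<lparr>carrier := semigroup_closure (V_monoid R)
                          (subsemigroup_generated (V_monoid R) {iso_class R B})\<rparr>"
proof -
  interpret E: idempotent_rng R \<alpha>
    using assms(1-3) by (intro idempotent_rng.intro idempotent_rng_axioms.intro)
  have "V_tensor S R B \<in> hom (V_monoid S)
      (V_monoid R\<lparr>carrier := semigroup_closure (V_monoid R)
        (subsemigroup_generated (V_monoid R) {iso_class R B})\<rparr>)"
    using E.V_tensor_hom E.V_tensor_image E.closure_multiples
    unfolding S_def B_def hom_def by auto
  moreover have "bij_betw (V_tensor S R B) (carrier (V_monoid S))
      (semigroup_closure (V_monoid R) (subsemigroup_generated (V_monoid R) {iso_class R B}))"
    using E.V_tensor_inj E.V_tensor_image E.closure_multiples
    unfolding S_def B_def bij_betw_def by simp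
  ultimately have "V_monoid S \<cong> V_monoid R\<lparr>carrier := semigroup_closure (V_monoid R)
      (subsemigroup_generated (V_monoid R) {iso_class R B})\<rparr>"
    by (auto simp: is_iso_def iso_def)
  then show ?thesis
    using E.V_tensor_tensor E.tensor_corner(1) E.corner_generated_fg_projective
      E.V_tensor_hom E.V_tensor_inj
    unfolding S_def B_def by blast
qed

end
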